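(* Let $\mathbb{K}$ be a field of characteristic $0$. The quadratic operad $\mathcal{J}a\mathcal{J}o$ over $\mathbb{K}$ whose algebras are the Jacobi-Jordan algebras is not a Koszul operad.
   Context: A Jacobi-Jordan algebra is a $\mathbb{K}$-vector space with a commutative bilinear product satisfying $x_1(x_2x_3)+x_2(x_3x_1)+x_3(x_1x_2)=0$. $\mathcal{J}a\mathcal{J}o$ is the binary quadratic symmetric operad generated by one commutative binary operation (the trivial representation of $\Sigma_2$), with ideal of relations generated by $x_1(x_2x_3)+x_2(x_3x_1)+x_3(x_1x_2)$. Koszulness is in the usual sense of Ginzburg–Kapranov. *)

theory Defs
  imports Complex_Main "HOL-Library.FuncSet" "HOL-Library.Nat_Bijection"
begin

section \<open>Binary quadratic operads by generators and relations\<close>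

text \<open>
  Operads are treated as functors on finite sets of labels: an operad \<open>P\<close> has a vector space
  \<open>P(I)\<close> for each finite set \<open>I\<close> of natural numbers, relabelling along bijections, and partial
  compositions \<open>P(I) \<otimes> P(J) \<rightarrow> P((I - {i}) \<union> J)\<close>.

  A \<open>\<Sigma>\<^sub>2\<close>-module \<open>E\<close> is given by a finite basis \<^typ>\<open>'e\<close> and the matrix of the transposition:
  \<open>e(y, x) = \<Sum>f. flip_matrix e f * f(x, y)\<close>.  The free operad on \<open>E\<close> is the quotient of the
  free nonassociative (magmatic) operad on \<^typ>\<open>'e\<close>, whose \<open>I\<close>-component \<open>vecs I\<close> has as basis the
  monomials in which each label of \<open>I\<close> occurs exactly once, by these symmetry relations; the operad
  \<open>P(E, R)\<close> is obtained by dividing out \<open>R\<close> (in arity three) as well.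
\<close>

datatype 'e mag = Lf nat | Op 'e "'e mag" "'e mag"

type_synonym ('e, 'k) vec = "'e mag \<Rightarrow> 'k"

primrec labels :: "'e mag \<Rightarrow> nat set" where
  "labels (Lf i) = {i}"
| "labels (Op e l r) = labels l \<union> labels r"

primrec multilinear :: "'e mag \<Rightarrow> bool" where
  "multilinear (Lf i) = True"
| "multilinear (Op e l r) = (multilinear l \<and> multilinear r \<and> labels l \<inter> labels r = {})"

definition mons :: "nat set \<Rightarrow> 'e mag set" where
  "mons I = {t. multilinear t \<and> labels t = I}"

definition vecs :: "nat set \<Rightarrow> ('e, 'k::field) vec set" where
  "vecs I = {x. \<forall>t. x t \<noteq> 0 \<longrightarrow> t \<in> mons I}"

definition single :: "'e mag \<Rightarrow> ('e, 'k::field) vec" where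
  "single t = (\<lambda>u. if u = t then 1 else 0)"

primrec subst :: "(nat \<Rightarrow> 'e mag) \<Rightarrow> 'e mag \<Rightarrow> 'e mag" where
  "subst \<sigma> (Lf i) = \<sigma> i"
| "subst \<sigma> (Op e l r) = Op e (subst \<sigma> l) (subst \<sigma> r)"

definition relabel :: "(nat \<Rightarrow> nat) \<Rightarrow> ('e, 'k::field) vec \<Rightarrow> ('e, 'k) vec" where
  "relabel f x = (\<lambda>w. \<Sum>t | x t \<noteq> 0 \<and> subst (\<lambda>i. Lf (f i)) t = w. x t)"

text \<open>The partial composition \<open>x \<circ>\<^sub>i y\<close>.\<close>

definition pcomp :: "nat \<Rightarrow> ('e, 'k::field) vec \<Rightarrow> ('e, 'k) vec \<Rightarrow> ('e, 'k) vec" where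
  "pcomp i x y =
    (\<lambda>w. \<Sum>(t, u) | x t \<noteq> 0 \<and> y u \<noteq> 0 \<and> subst (Lf(i := u)) t = w. x t * y u)"

record ('e, 'k) quadratic =
  flip_matrix :: "'e \<Rightarrow> 'e \<Rightarrow> 'k"
  rels :: "('e, 'k) vec set"

definition quadratic_data :: "('e::finite, 'k::field) quadratic \<Rightarrow> bool" where
  "quadratic_data P \<longleftrightarrow>
    (\<forall>e g. (\<Sum>f\<in>UNIV. flip_matrix P e f * flip_matrix P f g) = (if e = g then 1 else 0)) \<and>
    rels P \<subseteq> vecs {1, 2, 3}"

text \<open>
  \<open>ideal P I x\<close>: the vector \<open>x\<close> lies in the \<open>I\<close>-component of the operadic ideal generated by the
  symmetry relations and by \<open>rels P\<close>.  The operad presented by \<open>P\<close> is thus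
  \<open>I \<mapsto> vecs I / ideal P I\<close>.
\<close>

inductive ideal :: "('e::finite, 'k::field) quadratic \<Rightarrow> nat set \<Rightarrow> ('e, 'k) vec \<Rightarrow> bool"
  for P where
  symm: "ideal P {1, 2} (\<lambda>t. single (Op e (Lf 2) (Lf 1)) t
           - (\<Sum>f\<in>UNIV. flip_matrix P e f * single (Op f (Lf 1) (Lf 2)) t))"
| rel: "r \<in> rels P \<Longrightarrow> ideal P {1, 2, 3} r"
| zero: "ideal P I (\<lambda>_. 0)"
| lin: "ideal P I x \<Longrightarrow> ideal P I y \<Longrightarrow> ideal P I (\<lambda>t. c * x t + y t)"
| relabel: "ideal P I x \<Longrightarrow> inj_on f I \<Longrightarrow> ideal P (f ` I) (relabel f x)"
| comp_left: "ideal P I x \<Longrightarrow> y \<in> vecs J \<Longrightarrow> i \<in> I \<Longrightarrow> (I - {i}) \<inter> J = {}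
    \<Longrightarrow> ideal P ((I - {i}) \<union> J) (pcomp i x y)"
| comp_right: "x \<in> vecs I \<Longrightarrow> ideal P J y \<Longrightarrow> i \<in> I \<Longrightarrow> (I - {i}) \<inter> J = {}
    \<Longrightarrow> ideal P ((I - {i}) \<union> J) (pcomp i x y)"


section \<open>The quadratic dual\<close>

text \<open>
  The dual has generators \<open>E\<^sup>\<or> = E\<^sup>* \<otimes> sgn\<close>, for which we use the dual basis, again indexed by
  \<^typ>\<open>'e\<close>.  Modulo symmetry, every element of the free operad in arity three is a unique combination of
  the monomials \<open>combs\<close>, that is \<open>a(b(1,2),3)\<close>, \<open>a(b(2,3),1)\<close> and \<open>a(b(3,1),2)\<close>.  The
  sign-equivariant pairing of \<open>F(E\<^sup>\<or>)(3)\<close> with \<open>F(E)(3)\<close> is the one that makes these monomials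
  dual to each other, and \<open>perp P\<close> is the annihilator of the arity-three relations
  (all of them, i.e. of the \<open>\<Sigma>\<^sub>3\<close>-module generated by \<open>rels P\<close>).
\<close>

definition combs :: "'e mag set" where
  "combs = {Op a (Op b (Lf i) (Lf j)) (Lf k) | a b i j k.
              (i, j, k) \<in> {(1, 2, 3), (2, 3, 1), (3, 1, 2)}}"

definition perp :: "('e::finite, 'k::field) quadratic \<Rightarrow> ('e, 'k) vec set" where
  "perp P = {y. (\<forall>t. y t \<noteq> 0 \<longrightarrow> t \<in> combs) \<and>
     (\<forall>r. ideal P {1, 2, 3} r \<and> (\<forall>t. r t \<noteq> 0 \<longrightarrow> t \<in> combs) \<longrightarrow> (\<Sum>t\<in>combs. y t * r t) = 0)}"

definition quad_dual :: "('e::finite, 'k::field) quadratic \<Rightarrow> ('e, 'k) quadratic" where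
  "quad_dual P = \<lparr>flip_matrix = (\<lambda>e f. - flip_matrix P f e), rels = perp P\<rparr>"


section \<open>The dual dg operad (cobar complex)\<close>

text \<open>
  An isomorphism class of reduced rooted trees with leaves \<open>1, \<dots>, n\<close> is given by the laminar family
  of the leaf sets of its internal vertices.  Internal edges correspond to the vertices other
  than the root \<open>{1..n}\<close>; for \<open>n = 1\<close> the empty family is the tree without vertices.
  An input of a vertex (a child) is labelled by the least leaf above it.
\<close>

definition trees :: "nat \<Rightarrow> nat set set set" where
  "trees n = {T. (\<forall>v\<in>T. v \<subseteq> {1..n} \<and> 2 \<le> card v) \<and>
     (\<forall>v\<in>T. \<forall>w\<in>T. v \<subseteq> w \<or> w \<subseteq> v \<or> v \<inter> w = {}) \<and>
     (2 \<le> n \<longrightarrow> {1..n} \<in> T)}"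

definition children :: "nat set set \<Rightarrow> nat set \<Rightarrow> nat set set" where
  "children T v =
     {c. (c \<in> T \<or> (\<exists>i. c = {i})) \<and> c \<subset> v \<and> \<not> (\<exists>d\<in>T. c \<subset> d \<and> d \<subset> v)}"

definition inputs :: "nat set set \<Rightarrow> nat set \<Rightarrow> nat set" where
  "inputs T v = Min ` children T v"

definition parent :: "nat set set \<Rightarrow> nat set \<Rightarrow> nat set" where
  "parent T e = \<Inter> {p \<in> T. e \<subset> p}"

definition decs :: "nat set set \<Rightarrow> (nat set \<Rightarrow> ('e, 'k::field) vec) set" where
  "decs T = (\<Pi>\<^sub>E v\<in>T. vecs (inputs T v))"

text \<open>
  \<open>dual_space Q T\<close> is \<open>Q(T)\<^sup>*\<close> for \<open>Q(T) = \<Otimes>v\<in>T. Q(inputs T v)\<close>, realised as the space of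
  multilinear functionals on decorations of the vertices which vanish whenever some vertex is decorated
  by an element of the ideal (and, as a normalisation, off the set of decorations).
\<close>

definition dual_space ::
    "('e::finite, 'k::field) quadratic \<Rightarrow> nat set set \<Rightarrow> ((nat set \<Rightarrow> ('e, 'k) vec) \<Rightarrow> 'k) set" where
  "dual_space Q T = {\<phi>.
     (\<forall>x. x \<notin> decs T \<longrightarrow> \<phi> x = 0) \<and>
     (\<forall>x\<in>decs T. \<forall>v\<in>T. \<forall>y\<in>vecs (inputs T v). \<forall>z\<in>vecs (inputs T v). \<forall>c.
        \<phi> (x(v := (\<lambda>t. c * y t + z t))) = c * \<phi> (x(v := y)) + \<phi> (x(v := z))) \<and>
     (\<forall>x\<in>decs T. \<forall>v\<in>T. ideal Q (inputs T v) (x v) \<longrightarrow> \<phi> x = 0)}"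

type_synonym ('e, 'k) cochain = "nat set set \<Rightarrow> (nat set \<Rightarrow> ('e, 'k) vec) \<Rightarrow> 'k"

text \<open>
  \<open>cobar Q n k\<close> is the direct sum of \<open>Q(T)\<^sup>* \<otimes> Det(T)\<close> over the trees \<open>T\<close> with \<open>n\<close> leaves and \<open>k\<close>
  vertices; the binary trees sit in the top degree \<open>k = n - 1\<close>.  Here \<open>Det(T)\<close> is the top exterior
  power of the space spanned by the internal edges; its basis vector is the product of
  the edges in increasing order of \<^const>\<open>set_encode\<close>, an injection of finite sets of naturals into the
  naturals.  The sign in the differential comes from moving the contracted edge to the front.
\<close>

definition cobar :: "('e::finite, 'k::field) quadratic \<Rightarrow> nat \<Rightarrow> nat \<Rightarrow> ('e, 'k) cochain set" where
  "cobar Q n k = {\<Phi>. \<forall>T. if T \<in> trees n \<and> card T = k then \<Phi> T \<in> dual_space Q T else \<Phi> T = (\<lambda>_. 0)}"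

definition contract ::
    "nat set set \<Rightarrow> nat set \<Rightarrow> (nat set \<Rightarrow> ('e, 'k::field) vec) \<Rightarrow> nat set \<Rightarrow> ('e, 'k) vec" where
  "contract T e x =
     restrict (x(parent T e := pcomp (Min e) (x (parent T e)) (x e))) (T - {e})"

definition cobar_d :: "nat \<Rightarrow> ('e, 'k::field) cochain \<Rightarrow> ('e, 'k) cochain" where
  "cobar_d n \<Phi> = (\<lambda>T x.
     if T \<in> trees n \<and> x \<in> decs T
     then \<Sum>e\<in>T - {{1..n}}. (- 1) ^ card {f \<in> T. set_encode f < set_encode e} *
            \<Phi> (T - {e}) (contract T e x)
     else 0)"

definition cocycles :: "('e::finite, 'k::field) quadratic \<Rightarrow> nat \<Rightarrow> nat \<Rightarrow> ('e, 'k) cochain set" where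
  "cocycles Q n k = {\<Phi> \<in> cobar Q n k. cobar_d n \<Phi> = (\<lambda>_ _. 0)}"

definition coboundaries :: "('e::finite, 'k::field) quadratic \<Rightarrow> nat \<Rightarrow> nat \<Rightarrow> ('e, 'k) cochain set" where
  "coboundaries Q n k = (if k = 0 then {\<lambda>_ _. 0} else cobar_d n ` cobar Q n (k - 1))"


section \<open>The canonical morphism and Koszulness\<close>

text \<open>
  A binary tree whose vertices are labelled by generators is written uniquely as an
  \<open>increasing\<close> monomial \<open>t\<close>: at each vertex the left child contains the smaller least leaf.
  \<open>vertices t\<close> is the underlying tree and \<open>decoration t\<close> its decoration by generators.
\<close>

primrec increasing :: "'e mag \<Rightarrow> bool" where
  "increasing (Lf i) = True"
| "increasing (Op e l r) = (increasing l \<and> increasing r \<and> Min (labels l) < Min (labels r))"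

primrec vertices :: "'e mag \<Rightarrow> nat set set" where
  "vertices (Lf i) = {}"
| "vertices (Op e l r) = insert (labels l \<union> labels r) (vertices l \<union> vertices r)"

primrec decoration :: "'e mag \<Rightarrow> nat set \<Rightarrow> ('e, 'k::field) vec" where
  "decoration (Lf i) = (\<lambda>_. undefined)"
| "decoration (Op e l r) = (\<lambda>v.
     if v = labels l \<union> labels r then single (Op e (Lf (Min (labels l))) (Lf (Min (labels r))))
     else if v \<subseteq> labels l then decoration l v
     else decoration r v)"

text \<open>
  The top degree of the cobar complex of \<open>quad_dual P\<close> has the summands \<open>E\<^sup>\<or>(T)\<^sup>* \<otimes> Det(T)\<close> for binary \<open>T\<close>.
  Since \<open>E\<^sup>\<or> = E\<^sup>* \<otimes> sgn\<close>, its identification with the free operad on \<open>E\<close> uses the isomorphism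
  (for fixed order of the leaves) between \<open>Det(T)\<close> and the tensor product, over the vertices, of
  the top exterior powers of the spaces spanned by the two inputs.  All inputs
  of all vertices together are the internal edges and the leaves, so \<open>orientation t\<close> is the sign of the
  permutation which sorts the list of the pairs of inputs into first the edges (as ordered in
  \<open>Det(T)\<close>) and then the leaves.  The order in which the vertices are listed does not matter.
\<close>

primrec input_list :: "'e mag \<Rightarrow> nat set list" where
  "input_list (Lf i) = []"
| "input_list (Op e l r) = [labels l, labels r] @ input_list l @ input_list r"

definition node_less :: "nat set \<Rightarrow> nat set \<Rightarrow> bool" where
  "node_less c d \<longleftrightarrow>
     (if (card c = 1) = (card d = 1) then set_encode c < set_encode d else card d = 1)"

definition orientation :: "'e mag \<Rightarrow> 'k::field" where
  "orientation t = (let xs = input_list t in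
     (- 1) ^ card {(i, j). i < j \<and> j < length xs \<and> node_less (xs ! j) (xs ! i)})"

text \<open>
  The morphism of the cobar complex to the operad \<open>P\<close>, in top degree (it is zero in all other
  degrees); its values are to be read modulo \<open>ideal P {1..n}\<close>.
\<close>

definition to_operad :: "nat \<Rightarrow> ('e, 'k::field) cochain \<Rightarrow> ('e, 'k) vec" where
  "to_operad n \<Phi> = (\<lambda>t.
     if t \<in> mons {1..n} \<and> increasing t then orientation t * \<Phi> (vertices t) (decoration t) else 0)"

text \<open>
  \<open>P\<close> is Koszul if the canonical morphism from the dual dg operad of \<open>quad_dual P\<close> to \<open>P\<close> is a
  quasi-isomorphism: the cobar complex is exact below the top degree, and in top degree its cohomology
  is mapped injectively (second clause) and surjectively (third clause) to \<open>P\<close>.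
\<close>

definition koszul :: "('e::finite, 'k::field) quadratic \<Rightarrow> bool" where
  "koszul P \<longleftrightarrow> (\<forall>n\<ge>1.
     (\<forall>k<n - 1. cocycles (quad_dual P) n k = coboundaries (quad_dual P) n k) \<and>
     {\<Phi> \<in> cobar (quad_dual P) n (n - 1). ideal P {1..n} (to_operad n \<Phi>)}
       = coboundaries (quad_dual P) n (n - 1) \<and>
     (\<forall>x\<in>vecs {1..n}. \<exists>\<Phi>\<in>cobar (quad_dual P) n (n - 1). ideal P {1..n} (\<lambda>t. x t - to_operad n \<Phi> t)))"


section \<open>The operad of Jacobi-Jordan algebras\<close>

abbreviation jj_mult :: "unit mag \<Rightarrow> unit mag \<Rightarrow> unit mag" (infixl "\<odot>" 70) where
  "s \<odot> t \<equiv> Op () s t"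

definition JaJo :: "(unit, 'k::field) quadratic" where
  "JaJo = \<lparr>flip_matrix = (\<lambda>_ _. 1),
     rels = {\<lambda>t. single (Lf 1 \<odot> (Lf 2 \<odot> Lf 3)) t + single (Lf 2 \<odot> (Lf 3 \<odot> Lf 1)) t
                 + single (Lf 3 \<odot> (Lf 1 \<odot> Lf 2)) t}\<rparr>"

lemma quadratic_data_JaJo: "quadratic_data (JaJo :: (unit, 'k::field) quadratic)"
  by (auto simp: quadratic_data_def JaJo_def vecs_def mons_def single_def split: if_splits)

end

theory Submission
  imports Defs
begin

text \<open>
  The quadratic dual \<open>Q\<close> of \<open>JaJo\<close> is generated by an anticommutative product with
  \<open>(xy)z = (yz)x\<close>.  Hence \<open>Q(2)\<close> and \<open>Q(3)\<close> are the sign representations.  In arity four,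
  \<open>((xy)z)w\<close> is totally antisymmetric and equal to \<open>- (xy)(zw)\<close>; exchanging \<open>xy\<close> with \<open>zw\<close> is an
  even permutation of the letters but changes the sign of \<open>(xy)(zw)\<close>, so \<open>Q(4) = 0\<close>.
  The cobar complex of \<open>Q\<close> therefore lives on trees with vertices of arity two and three.

  In arity five the complex has dimensions 10, 105, 105 in degrees 2, 3, 4, and the last differential
  has a kernel of dimension 15, so that the cohomology in degree 3 cannot vanish.  It is
  enough to give one cocycle which is nonzero on a tree \<open>T\<close> such that contracting any edge
  of \<open>T\<close> creates a vertex of arity four: coboundaries vanish there.
\<close>

section \<open>Finitely supported vectors as functionals\<close>

text \<open>Membership in an operadic ideal has to be controlled from both sides. That a monomial
  lies in the ideal is shown by an explicit chain of rewriting steps; that a vector lies outside is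
  shown by evaluation in a concrete algebra over the operad, where the whole ideal vanishes. Since
  \<open>perp JaJo\<close> is defined by all arity-three relations of \<open>JaJo\<close>, even a
  single element of it requires an upper bound on that ideal, so an algebra is built for
  \<open>JaJo\<close> as well as for its dual. The algebra for the dual also yields the generators
  of the duals of Q(2) and Q(3). In terms of these the differential becomes a table of integer
  signs, so the cocycle equations can be checked over the integers and hold over every field.
  Characteristic zero enters through a division by 2 in the proof that Q(4) vanishes.\<close>

lemma labels_nonempty: "labels t \<noteq> {}"
  by (induction t) auto

lemma finite_labels: "finite (labels t)"
  by (induction t) auto

text \<open>In a product both factors have nonempty, disjoint label sets, so each uses a proper
  subset of \<open>I\<close> and strong induction applies; an infinite \<open>I\<close> carries no
  monomials at all.\<close>

lemma finite_mons: "finite (mons I :: 'e::finite mag set)"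
proof (cases "finite I")
  case True
  then show ?thesis
  proof (induction I rule: finite_psubset_induct)
    case (psubset I)
    let ?op = "\<lambda>(e::'e, l, r). Op e l r"
    have "mons I \<subseteq> Lf ` I \<union> (\<Union>J\<in>{J. J \<subset> I}. \<Union>K\<in>{K. K \<subset> I}. ?op ` (UNIV \<times> mons J \<times> mons K))"
    proof
      fix t :: "'e mag"
      assume t: "t \<in> mons I"
      show "t \<in> Lf ` I \<union> (\<Union>J\<in>{J. J \<subset> I}. \<Union>K\<in>{K. K \<subset> I}. ?op ` (UNIV \<times> mons J \<times> mons K))"
      proof (cases t)
        case (Op e l r)
        then have sub: "labels l \<subset> I" "labels r \<subset> I" and "l \<in> mons (labels l)" "r \<in> mons (labels r)"
          using t labels_nonempty[of l] labels_nonempty[of r] by (auto simp: mons_def)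
        then have "t \<in> ?op ` (UNIV \<times> mons (labels l) \<times> mons (labels r))"
          unfolding Op by (intro image_eqI[where x = "(e, l, r)"]) auto
        with sub show ?thesis by blast
      qed (use t in \<open>auto simp: mons_def\<close>)
    qed
    moreover have "finite {J. J \<subset> I}"
      by (rule finite_subset[of _ "Pow I"]) (use psubset.hyps in auto)
    then have "finite (\<Union>J\<in>{J. J \<subset> I}. \<Union>K\<in>{K. K \<subset> I}. ?op ` (UNIV \<times> mons J \<times> mons K))"
      using psubset.IH by auto
    then have "finite (Lf ` I \<union> (\<Union>J\<in>{J. J \<subset> I}. \<Union>K\<in>{K. K \<subset> I}. ?op ` (UNIV \<times> mons J \<times> mons K)))"
      using psubset.hyps by simp
    ultimately show ?case by (rule finite_subset)
  qed
next
  case False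
  then have "mons I = ({} :: 'e mag set)" using finite_labels by (auto simp: mons_def)
  then show ?thesis by simp
qed

lemma finite_support:
  assumes "x \<in> vecs I"
  shows "finite {t :: 'e::finite mag. x t \<noteq> 0}"
  using assms finite_mons[of I] by (auto simp: vecs_def intro: finite_subset)

lemma vecs_lin: "x \<in> vecs I \<Longrightarrow> y \<in> vecs I \<Longrightarrow> (\<lambda>t. c * x t + y t) \<in> vecs I"
  unfolding vecs_def by (auto, metis add.right_neutral mult_zero_right)

lemma vecs_zero: "(\<lambda>_. 0) \<in> vecs I"
  by (auto simp: vecs_def)

lemma single_in_vecs: "t \<in> mons I \<Longrightarrow> single t \<in> vecs I"
  by (auto simp: vecs_def single_def)

lemma labels_subst: "labels (subst \<sigma> t) = (\<Union>i\<in>labels t. labels (\<sigma> i))"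
  by (induction t) auto

lemma multilinear_subst:
  assumes "multilinear t" "\<And>i. i \<in> labels t \<Longrightarrow> multilinear (\<sigma> i)"
    "\<And>i j. i \<in> labels t \<Longrightarrow> j \<in> labels t \<Longrightarrow> i \<noteq> j \<Longrightarrow> labels (\<sigma> i) \<inter> labels (\<sigma> j) = {}"
  shows "multilinear (subst \<sigma> t)"
  using assms
proof (induction t)
  case (Op e l r)
  have "labels (\<sigma> i) \<inter> labels (\<sigma> j) = {}" if "i \<in> labels l" "j \<in> labels r" for i j
    using Op.prems(1) Op.prems(3)[of i j] that by auto
  then show ?case using Op by (auto simp: labels_subst)
qed auto

lemma subst_in_mons:
  assumes "t \<in> mons I" "u \<in> mons J" "i \<in> I" "(I - {i}) \<inter> J = {}"
  shows "subst (Lf(i := u)) t \<in> mons ((I - {i}) \<union> J)"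
  using assms by (auto simp: mons_def labels_subst split: if_splits intro!: multilinear_subst)

lemma relabel_in_mons:
  assumes "t \<in> mons I" "inj_on f I"
  shows "subst (\<lambda>i. Lf (f i)) t \<in> mons (f ` I)"
  using assms by (auto simp: mons_def labels_subst inj_on_def intro!: multilinear_subst)

text \<open>The junk value is 0 when the support of \<open>x\<close> is infinite; elements of \<open>vecs I\<close> have finite support.\<close>

definition pairing :: "('e, 'k::field) vec \<Rightarrow> ('e mag \<Rightarrow> 'k) \<Rightarrow> 'k" where
  "pairing x g = (\<Sum>t | x t \<noteq> 0. x t * g t)"

lemma pairing_eq_sum:
  assumes "finite A" "{t. x t \<noteq> 0} \<subseteq> A"
  shows "pairing x g = (\<Sum>t\<in>A. x t * g t)"
  unfolding pairing_def using assms by (intro sum.mono_neutral_left) auto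

lemma pairing_vecs:
  fixes x :: "('e::finite, 'k::field) vec"
  assumes "x \<in> vecs I"
  shows "pairing x g = (\<Sum>t\<in>mons I. x t * g t)"
  using assms by (intro pairing_eq_sum finite_mons) (auto simp: vecs_def)

lemma pairing_lin:
  fixes x :: "('e::finite, 'k::field) vec"
  assumes "x \<in> vecs I" "y \<in> vecs I"
  shows "pairing (\<lambda>t. c * x t + y t) g = c * pairing x g + pairing y g"
  using assms by (simp add: pairing_vecs[of _ I] vecs_lin distrib_right sum.distrib sum_distrib_left mult.assoc)

lemma pairing_single: "pairing (single t) g = g t"
  by (subst pairing_eq_sum[of "{t}"]) (auto simp: single_def)

section \<open>Composition and relabelling seen through the pairing\<close>

lemma pcomp_nonzero:
  assumes "pcomp i x y w \<noteq> 0"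
  obtains t u where "x t \<noteq> 0" "y u \<noteq> 0" "w = subst (Lf(i := u)) t"
  using assms unfolding pcomp_def by (elim sum.not_neutral_contains_not_neutral) auto

lemma relabel_nonzero:
  assumes "relabel f x w \<noteq> 0"
  obtains t where "x t \<noteq> 0" "w = subst (\<lambda>i. Lf (f i)) t"
  using assms unfolding relabel_def by (elim sum.not_neutral_contains_not_neutral) auto

lemma pcomp_in_vecs:
  assumes "x \<in> vecs I" "y \<in> vecs J" "i \<in> I" "(I - {i}) \<inter> J = {}"
  shows "pcomp i x y \<in> vecs ((I - {i}) \<union> J)"
proof -
  have "w \<in> mons ((I - {i}) \<union> J)" if w: "pcomp i x y w \<noteq> 0" for w
    using w
  proof (rule pcomp_nonzero)
    fix t u assume "x t \<noteq> 0" "y u \<noteq> 0" "w = subst (Lf(i := u)) t"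
    then show ?thesis using subst_in_mons[of t I u J i] assms by (auto simp: vecs_def)
  qed
  then show ?thesis by (simp add: vecs_def)
qed

lemma relabel_in_vecs:
  assumes "x \<in> vecs I" "inj_on f I"
  shows "relabel f x \<in> vecs (f ` I)"
proof -
  have "w \<in> mons (f ` I)" if w: "relabel f x w \<noteq> 0" for w
    using w
  proof (rule relabel_nonzero)
    fix t assume "x t \<noteq> 0" "w = subst (\<lambda>i. Lf (f i)) t"
    then show ?thesis using relabel_in_mons[of t I f] assms by (auto simp: vecs_def)
  qed
  then show ?thesis by (simp add: vecs_def)
qed

text \<open>\<open>pcomp\<close> sums over the pairs that graft to the same monomial; regrouping all
  pairs along the fibres of the grafting map gives an iterated pairing, in which such collisions no
  longer matter.\<close>

lemma pairing_pcomp: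
  assumes fin: "finite {t. x t \<noteq> 0}" "finite {u. y u \<noteq> 0}"
  shows "pairing (pcomp i x y) g = pairing x (\<lambda>t. pairing y (\<lambda>u. g (subst (Lf(i := u)) t)))"
proof -
  let ?S = "{t. x t \<noteq> 0} \<times> {u. y u \<noteq> 0}"
  let ?s = "\<lambda>(t, u). subst (Lf(i := u)) t"
  have "pairing (pcomp i x y) g = (\<Sum>w\<in>?s ` ?S. pcomp i x y w * g w)"
    using fin by (intro pairing_eq_sum) (auto elim!: pcomp_nonzero)
  also have "\<dots> = (\<Sum>w\<in>?s ` ?S. \<Sum>p\<in>{p \<in> ?S. ?s p = w}. x (fst p) * y (snd p) * g (?s p))"
  proof (intro sum.cong refl)
    fix w
    have "{(t, u). x t \<noteq> 0 \<and> y u \<noteq> 0 \<and> subst (Lf(i := u)) t = w} = {p \<in> ?S. ?s p = w}" by auto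
    then show "pcomp i x y w * g w = (\<Sum>p\<in>{p \<in> ?S. ?s p = w}. x (fst p) * y (snd p) * g (?s p))"
      by (simp add: pcomp_def sum_distrib_right case_prod_beta)
  qed
  also have "\<dots> = (\<Sum>p\<in>?S. x (fst p) * y (snd p) * g (?s p))"
    using fin by (intro sum.image_gen[symmetric]) simp
  also have "\<dots> = (\<Sum>t | x t \<noteq> 0. \<Sum>u | y u \<noteq> 0. x t * y u * g (subst (Lf(i := u)) t))"
    by (simp add: sum.cartesian_product case_prod_beta)
  finally show ?thesis by (simp add: pairing_def sum_distrib_left mult.assoc)
qed

lemma pairing_relabel:
  assumes fin: "finite {t. x t \<noteq> 0}"
  shows "pairing (relabel f x) g = pairing x (\<lambda>t. g (subst (\<lambda>i. Lf (f i)) t))"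
proof -
  let ?S = "{t. x t \<noteq> 0}"
  let ?s = "subst (\<lambda>i. Lf (f i))"
  have "pairing (relabel f x) g = (\<Sum>w\<in>?s ` ?S. relabel f x w * g w)"
    using fin by (intro pairing_eq_sum) (auto elim!: relabel_nonzero)
  also have "\<dots> = (\<Sum>w\<in>?s ` ?S. \<Sum>t\<in>{t \<in> ?S. ?s t = w}. x t * g (?s t))"
    by (intro sum.cong refl) (simp add: relabel_def sum_distrib_right)
  also have "\<dots> = (\<Sum>t\<in>?S. x t * g (?s t))"
    using fin by (intro sum.image_gen[symmetric])
  finally show ?thesis by (simp add: pairing_def)
qed

section \<open>Evaluation in algebras\<close>

primrec ev :: "('e \<Rightarrow> 'v \<Rightarrow> 'v \<Rightarrow> 'v) \<Rightarrow> (nat \<Rightarrow> 'v) \<Rightarrow> 'e mag \<Rightarrow> 'v" where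
  "ev m a (Lf i) = a i"
| "ev m a (Op e l r) = m e (ev m a l) (ev m a r)"

lemma ev_subst: "ev m a (subst \<sigma> t) = ev m (\<lambda>i. ev m a (\<sigma> i)) t"
  by (induction t) auto

lemma ev_cong: "(\<And>i. i \<in> labels t \<Longrightarrow> a i = b i) \<Longrightarrow> ev m a t = ev m b t"
  by (induction t) auto

definition bilinear_ops :: "('e \<Rightarrow> ('i \<Rightarrow> 'k::field) \<Rightarrow> ('i \<Rightarrow> 'k) \<Rightarrow> 'i \<Rightarrow> 'k) \<Rightarrow> bool" where
  "bilinear_ops m \<longleftrightarrow> (\<forall>e c u v w.
     m e (\<lambda>j. c * u j + v j) w = (\<lambda>j. c * m e u w j + m e v w j) \<and>
     m e w (\<lambda>j. c * u j + v j) = (\<lambda>j. c * m e w u j + m e w v j))"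

lemma bilinear_ops_zero:
  assumes "bilinear_ops m"
  shows "m e (\<lambda>_. 0) w = (\<lambda>_. 0)" "m e w (\<lambda>_. 0) = (\<lambda>_. 0)"
proof -
  \<comment> \<open>With scalar -1 and both vectors zero, the right-hand sides cancel.\<close>
  have "m e (\<lambda>j. (-1) * 0 + 0) w = (\<lambda>j. (-1) * m e (\<lambda>_. 0) w j + m e (\<lambda>_. 0) w j)"
    "m e w (\<lambda>j. (-1) * 0 + 0) = (\<lambda>j. (-1) * m e w (\<lambda>_. 0) j + m e w (\<lambda>_. 0) j)"
    using assms[unfolded bilinear_ops_def] by fast+
  then show "m e (\<lambda>_. 0) w = (\<lambda>_. 0)" "m e w (\<lambda>_. 0) = (\<lambda>_. 0)" by simp_all
qed

lemma bilinear_ops_sum: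
  assumes "bilinear_ops m" "finite Y"
  shows "m e (\<lambda>j. \<Sum>u\<in>Y. c u * b u j) w = (\<lambda>j. \<Sum>u\<in>Y. c u * m e (b u) w j)"
    "m e w (\<lambda>j. \<Sum>u\<in>Y. c u * b u j) = (\<lambda>j. \<Sum>u\<in>Y. c u * m e w (b u) j)"
  using assms(2)
proof (induction Y rule: finite_induct)
  case empty
  show "m e (\<lambda>j. \<Sum>u\<in>{}. c u * b u j) w = (\<lambda>j. \<Sum>u\<in>{}. c u * m e (b u) w j)"
    "m e w (\<lambda>j. \<Sum>u\<in>{}. c u * b u j) = (\<lambda>j. \<Sum>u\<in>{}. c u * m e w (b u) j)"
    by (simp_all add: bilinear_ops_zero[OF assms(1)])
next
  case (insert u Y)
  have "m e (\<lambda>j. c u * b u j + (\<Sum>u\<in>Y. c u * b u j)) w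
      = (\<lambda>j. c u * m e (b u) w j + m e (\<lambda>j. \<Sum>u\<in>Y. c u * b u j) w j)"
    "m e w (\<lambda>j. c u * b u j + (\<Sum>u\<in>Y. c u * b u j))
      = (\<lambda>j. c u * m e w (b u) j + m e w (\<lambda>j. \<Sum>u\<in>Y. c u * b u j) j)"
    using assms(1)[unfolded bilinear_ops_def, rule_format, of e "c u" "b u" _ w] by simp_all
  then show "m e (\<lambda>j. \<Sum>u\<in>insert u Y. c u * b u j) w = (\<lambda>j. \<Sum>u\<in>insert u Y. c u * m e (b u) w j)"
    "m e w (\<lambda>j. \<Sum>u\<in>insert u Y. c u * b u j) = (\<lambda>j. \<Sum>u\<in>insert u Y. c u * m e w (b u) j)"
    using insert by simp_all
qed

text \<open>The label \<open>i\<close> occurs in exactly one factor of each product, and the other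
  factor does not see the value at \<open>i\<close>; so the sum passes through one argument at a
  time.\<close>

lemma ev_multilinear:
  assumes m: "bilinear_ops m" and Y: "finite Y"
  shows "multilinear t \<Longrightarrow> i \<in> labels t \<Longrightarrow>
    ev m (a(i := \<lambda>j. \<Sum>u\<in>Y. c u * b u j)) t = (\<lambda>j. \<Sum>u\<in>Y. c u * ev m (a(i := b u)) t j)"
proof (induction t)
  case (Op e l r)
  have *: "ev m (a(i := v)) t = ev m a t" if "i \<notin> labels t" for t v
    using that by (intro ev_cong) auto
  let ?v = "\<lambda>j. \<Sum>u\<in>Y. c u * b u j"
  show ?case
  proof (cases "i \<in> labels l")
    case True
    then have r: "ev m (a(i := v)) r = ev m a r" for v using Op.prems by (intro *) auto
    have l: "ev m (a(i := ?v)) l = (\<lambda>j. \<Sum>u\<in>Y. c u * ev m (a(i := b u)) l j)"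
      using Op.prems True by (intro Op.IH(1)) auto
    show ?thesis unfolding ev.simps l r by (rule bilinear_ops_sum(1)[OF m Y])
  next
    case False
    then have l: "ev m (a(i := v)) l = ev m a l" for v by (intro *)
    have r: "ev m (a(i := ?v)) r = (\<lambda>j. \<Sum>u\<in>Y. c u * ev m (a(i := b u)) r j)"
      using Op.prems False by (intro Op.IH(2)) auto
    show ?thesis unfolding ev.simps l r by (rule bilinear_ops_sum(2)[OF m Y])
  qed
qed simp

section \<open>Vanishing of the ideal in algebras over the operad\<close>

lemma symm_in_vecs:
  "(\<lambda>t. single (Op e (Lf 2) (Lf 1)) t
     - (\<Sum>f\<in>UNIV. flip_matrix P e f * single (Op f (Lf 1) (Lf 2)) t)) \<in> vecs {1, 2}"
  (is "?x \<in> _")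
proof -
  have "t \<in> mons {1, 2}" if "?x t \<noteq> 0" for t
  proof (rule ccontr)
    assume t: "t \<notin> mons {1, 2}"
    then have "\<forall>f. t \<noteq> Op f (Lf 1) (Lf 2)" "t \<noteq> Op e (Lf 2) (Lf 1)" by (auto simp: mons_def)
    then have "?x t = 0" by (simp add: single_def)
    then show False using that by simp
  qed
  then show ?thesis by (simp add: vecs_def)
qed

lemma ideal_in_vecs:
  assumes "ideal P I x" "rels P \<subseteq> vecs {1, 2, 3}"
  shows "x \<in> vecs I"
  using assms
proof (induction rule: ideal.induct)
  case (symm e) show ?case by (rule symm_in_vecs)
next
  case (zero I) show ?case by (rule vecs_zero)
next
  case (lin I x y c) then show ?case by (intro vecs_lin) auto
next
  case (relabel I x f) then show ?case by (intro relabel_in_vecs)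
next
  case (comp_left I x y J i) then show ?case by (intro pcomp_in_vecs)
next
  case (comp_right x I J y i) then show ?case by (intro pcomp_in_vecs)
qed (simp add: subsetD)

text \<open>An algebra satisfying the generating relations satisfies all their consequences. This
  bounds the ideal from above: a vector with a nonzero value in some such algebra lies outside. The
  assignment varies in the induction because composition and relabelling change it.\<close>

lemma ideal_evaluates_to_zero:
  fixes P :: "('e::finite, 'k::field) quadratic"
  assumes x: "ideal P I x" and rels: "rels P \<subseteq> vecs {1, 2, 3}" and m: "bilinear_ops m"
    and m_symm: "\<And>e u v. m e v u = (\<lambda>j. \<Sum>f\<in>UNIV. flip_matrix P e f * m f u v j)"
    and m_rel: "\<And>r a j. r \<in> rels P \<Longrightarrow> pairing r (\<lambda>t. ev m a t j) = 0"
  shows "pairing x (\<lambda>t. ev m a t j) = 0"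
  using x
proof (induction arbitrary: a j rule: ideal.induct)
  case (symm e)
  let ?l = "Op e (Lf 2) (Lf 1)" and ?r = "\<lambda>f. Op f (Lf 1) (Lf 2)"
  let ?x = "\<lambda>t. single ?l t - (\<Sum>f\<in>UNIV. flip_matrix P e f * single (?r f) t)"
  have inj: "inj ?r" by (auto simp: inj_def)
  have "pairing ?x (\<lambda>t. ev m a t j) = (\<Sum>t\<in>insert ?l (range ?r). ?x t * ev m a t j)"
  proof (intro pairing_eq_sum subsetI)
    fix t assume t: "t \<in> {t. ?x t \<noteq> 0}"
    show "t \<in> insert ?l (range ?r)"
    proof (rule ccontr)
      assume "t \<notin> insert ?l (range ?r)"
      then have "t \<noteq> ?r f" "t \<noteq> ?l" for f by blast+
      then have "?x t = 0" by (simp add: single_def)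
      then show False using t by simp
    qed
  qed (rule finite.insertI, rule finite_imageI, rule finite)
  also have "\<dots> = ?x ?l * ev m a ?l j + (\<Sum>t\<in>range ?r. ?x t * ev m a t j)"
    by (rule sum.insert) auto
  also have "(\<Sum>t\<in>range ?r. ?x t * ev m a t j) = (\<Sum>f\<in>UNIV. ?x (?r f) * ev m a (?r f) j)"
    by (subst sum.reindex[OF inj]) (simp only: comp_def)
  also have "?x ?l = 1" by (simp add: single_def)
  also have "(\<Sum>f\<in>UNIV. ?x (?r f) * ev m a (?r f) j) = (\<Sum>f\<in>UNIV. - flip_matrix P e f * ev m a (?r f) j)"
    by (intro sum.cong refl)
      (simp add: single_def if_distrib[where f = "(*) c" for c] cong: if_cong)
  also have "ev m a ?l j = (\<Sum>f\<in>UNIV. flip_matrix P e f * m f (a 1) (a 2) j)"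
    using m_symm[of e "a 2" "a 1"] by simp
  finally show ?case by (simp add: sum_negf)
next
  case (rel r) then show ?case by (rule m_rel)
next
  case (zero I) show ?case by (simp add: pairing_def)
next
  case (lin I x y c)
  then have "x \<in> vecs I" "y \<in> vecs I" using ideal_in_vecs[OF _ rels] by blast+
  then show ?case using lin.IH by (simp add: pairing_lin)
next
  case (relabel I x f)
  then have "finite {t. x t \<noteq> 0}" using finite_support ideal_in_vecs[OF _ rels] by blast
  then show ?case by (simp only: pairing_relabel ev_subst ev.simps relabel.IH)
next
  case (comp_left I x y J i)
  have fin: "finite {t. x t \<noteq> 0}" "finite {u. y u \<noteq> 0}"
    using finite_support ideal_in_vecs[OF _ rels] comp_left by blast+
  let ?g = "\<lambda>t u. ev m (a(i := ev m a u)) t j"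
  have ev: "ev m a (subst (Lf(i := u)) t) j = ?g t u" for t u
    by (simp add: ev_subst fun_upd_def if_distrib[of "ev m a"] cong: if_cong)
  have "pairing (pcomp i x y) (\<lambda>t. ev m a t j) = pairing x (\<lambda>t. pairing y (?g t))"
    by (simp add: pairing_pcomp[OF fin] ev)
  \<comment> \<open>For each fixed \<open>u\<close> the monomials of \<open>x\<close> are evaluated
    under one assignment, changed only at \<open>i\<close>; with the sum over \<open>x\<close>
    innermost, the induction hypothesis applies.\<close>
  also have "\<dots> = pairing y (\<lambda>u. pairing x (\<lambda>t. ?g t u))"
    unfolding pairing_def sum_distrib_left
    by (subst sum.swap) (simp only: mult.left_commute)
  also have "\<dots> = 0" by (simp only: comp_left.IH) (simp add: pairing_def)
  finally show ?case .
next
  case (comp_right x I J y i)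
  have fin: "finite {t. x t \<noteq> 0}" "finite {u. y u \<noteq> 0}"
    using finite_support ideal_in_vecs[OF _ rels] comp_right by blast+
  let ?g = "\<lambda>t u. ev m (a(i := ev m a u)) t j"
  have ev: "ev m a (subst (Lf(i := u)) t) j = ?g t u" for t u
    by (simp add: ev_subst fun_upd_def if_distrib[of "ev m a"] cong: if_cong)
  \<comment> \<open>The input \<open>i\<close> of \<open>t\<close> receives the value of
    \<open>y\<close>, which is zero by the induction hypothesis; multilinearity in that input
    carries the zero outwards.\<close>
  have zero: "pairing y (?g t) = 0" if "x t \<noteq> 0" for t
  proof -
    have t: "multilinear t" "i \<in> labels t"
      using that comp_right by (auto simp: vecs_def mons_def)
    have "(\<lambda>j. pairing y (\<lambda>u. ev m (a(i := ev m a u)) t j)) =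
        ev m (a(i := \<lambda>j. \<Sum>u | y u \<noteq> 0. y u * ev m a u j)) t"
      unfolding pairing_def by (rule ev_multilinear[OF m fin(2) t, symmetric])
    also have "(\<lambda>j. \<Sum>u | y u \<noteq> 0. y u * ev m a u j) = (\<lambda>_. 0)"
      using comp_right.IH by (simp add: pairing_def)
    also have "ev m (a(i := \<lambda>_. 0)) t = (\<lambda>_. 0)"
      using ev_multilinear[OF m _ t, of "{}"] by simp
    finally show ?thesis by (rule fun_cong)
  qed
  show ?case by (simp add: pairing_pcomp[OF fin] ev) (simp add: pairing_def[of x] zero)
qed

section \<open>Substitution of monomials into relations\<close>

text \<open>To be read as a rewriting rule: s equals c times t modulo the ideal. With
  \<open>c = 0\<close> it is a single monomial, so the same lemmas serve relations and monomials;
  \<open>s = t\<close> is allowed, as the argument w = -w in arity four requires.\<close>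

definition two_term :: "'e mag \<Rightarrow> 'k \<Rightarrow> 'e mag \<Rightarrow> ('e, 'k::field) vec" where
  "two_term s c t = (\<lambda>u. single s u - c * single t u)"

lemma two_term_nonzero: "{u. two_term s c t u \<noteq> 0} \<subseteq> {s, t}"
  by (auto simp: two_term_def single_def split: if_splits)

lemma finite_two_term: "finite {u. two_term s c t u \<noteq> 0}"
  using two_term_nonzero by (rule finite_subset) simp

lemma pairing_two_term: "pairing (two_term s c t) g = g s - c * g t"
proof (cases "s = t")
  case True
  have "pairing (two_term s c t) g = (\<Sum>u\<in>{s}. two_term s c t u * g u)"
    using two_term_nonzero[of s c t] True by (intro pairing_eq_sum) auto
  then show ?thesis using True by (simp add: two_term_def single_def left_diff_distrib)
next
  case False
  have "pairing (two_term s c t) g = (\<Sum>u\<in>{s, t}. two_term s c t u * g u)"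
    by (intro pairing_eq_sum two_term_nonzero) simp
  then show ?thesis using False by (simp add: two_term_def single_def)
qed

lemma single_eq_two_term: "single s = two_term s 0 s"
  by (simp add: two_term_def)

lemma pairing_delta:
  assumes "finite {t. x t \<noteq> 0}"
  shows "pairing x (\<lambda>t. if t = w then 1 else 0) = x w"
proof -
  have "pairing x (\<lambda>t. if t = w then 1 else 0) = (\<Sum>t\<in>insert w {t. x t \<noteq> 0}. x t * (if t = w then 1 else 0))"
    using assms by (intro pairing_eq_sum) auto
  also have "\<dots> = (\<Sum>t\<in>insert w {t. x t \<noteq> 0}. if t = w then x t else 0)"
    by (intro sum.cong) auto
  also have "\<dots> = x w" using assms by (simp add: sum.delta)
  finally show ?thesis .
qed

lemma finite_pcomp:
  assumes "finite {t. x t \<noteq> 0}" "finite {u. y u \<noteq> 0}"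
  shows "finite {w. pcomp i x y w \<noteq> 0}"
proof (rule finite_subset)
  show "{w. pcomp i x y w \<noteq> 0} \<subseteq> (\<lambda>(t, u). subst (Lf(i := u)) t) ` ({t. x t \<noteq> 0} \<times> {u. y u \<noteq> 0})"
    by (auto elim!: pcomp_nonzero)
qed (use assms in simp)

lemma finite_relabel:
  assumes "finite {t. x t \<noteq> 0}"
  shows "finite {w. relabel f x w \<noteq> 0}"
proof (rule finite_subset)
  show "{w. relabel f x w \<noteq> 0} \<subseteq> subst (\<lambda>i. Lf (f i)) ` {t. x t \<noteq> 0}"
    by (auto elim!: relabel_nonzero)
qed (use assms in simp)

text \<open>Delta functionals separate vectors of finite support. Identities between compositions
  thus reduce to pairings, which \<open>pairing_pcomp\<close> and \<open>pairing_relabel\<close>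
  compute.\<close>

lemma vec_eqI:
  assumes "finite {t. x t \<noteq> 0}" "finite {t. y t \<noteq> 0}" "\<And>g. pairing x g = pairing y g"
  shows "x = y"
  using assms(3)[of "\<lambda>t. if t = w then 1 else 0" for w]
  unfolding pairing_delta[OF assms(1)] pairing_delta[OF assms(2)] by (rule ext)

lemma pcomp_two_term:
  "pcomp i (two_term s c t) (single u) = two_term (subst (Lf(i := u)) s) c (subst (Lf(i := u)) t)"
  unfolding single_eq_two_term
  by (intro vec_eqI finite_pcomp finite_two_term) (simp add: pairing_pcomp finite_two_term pairing_two_term)

lemma pcomp_single_two_term:
  "pcomp i (single u) (two_term s c t) = two_term (subst (Lf(i := s)) u) c (subst (Lf(i := t)) u)"
  unfolding single_eq_two_term
  by (intro vec_eqI finite_pcomp finite_two_term) (simp add: pairing_pcomp finite_two_term pairing_two_term)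

lemma pcomp_single: "pcomp i (single t) (single u) = single (subst (Lf(i := u)) t)"
  using pcomp_two_term[of i t 0 t u] by (simp add: single_eq_two_term)

lemma relabel_two_term:
  "relabel f (two_term s c t) = two_term (subst (\<lambda>i. Lf (f i)) s) c (subst (\<lambda>i. Lf (f i)) t)"
  by (intro vec_eqI finite_relabel finite_two_term) (simp add: pairing_relabel finite_two_term pairing_two_term)

lemma subst_subst: "subst \<sigma> (subst \<tau> t) = subst (\<lambda>i. subst \<sigma> (\<tau> i)) t"
  by (induction t) auto

lemma subst_Lf: "subst Lf t = t"
  by (induction t) auto

lemma subst_cong: "(\<And>i. i \<in> labels t \<Longrightarrow> \<sigma> i = \<tau> i) \<Longrightarrow> subst \<sigma> t = subst \<tau> t"
  by (induction t) auto

lemma subst_fresh: "a \<notin> labels t \<Longrightarrow> subst (Lf(a := u)) t = t"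
  by (induction t) auto

text \<open>Simultaneous substitution is carried out as one partial composition per label. Freshness
  keeps later compositions from touching labels that earlier ones have inserted.\<close>

lemma ideal_subst_fresh:
  assumes ideal: "ideal P I (two_term s c t)" and A: "finite A" "A \<subseteq> I"
    and mult: "\<And>i. i \<in> A \<Longrightarrow> multilinear (\<sigma> i)"
    and disj: "\<And>i j. i \<in> A \<Longrightarrow> j \<in> A \<Longrightarrow> i \<noteq> j \<Longrightarrow> labels (\<sigma> i) \<inter> labels (\<sigma> j) = {}"
    and fresh: "\<And>i. i \<in> A \<Longrightarrow> labels (\<sigma> i) \<inter> I = {}"
  shows "ideal P ((I - A) \<union> (\<Union>i\<in>A. labels (\<sigma> i)))
    (two_term (subst (\<lambda>i. if i \<in> A then \<sigma> i else Lf i) s) c (subst (\<lambda>i. if i \<in> A then \<sigma> i else Lf i) t))"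
  using A mult disj fresh
proof (induction A rule: finite_induct)
  case empty
  then show ?case using ideal by (simp add: subst_Lf)
next
  case (insert a A)
  let ?\<sigma> = "\<lambda>A i. if i \<in> A then \<sigma> i else Lf i"
  let ?K = "(I - A) \<union> (\<Union>i\<in>A. labels (\<sigma> i))"
  have a_fresh: "a \<notin> labels (\<sigma> i)" if "i \<in> A" for i
    using insert.prems(1) insert.prems(4)[of i] that by auto
  have "ideal P ?K (two_term (subst (?\<sigma> A) s) c (subst (?\<sigma> A) t))"
    using insert.prems by (intro insert.IH) auto
  then have "ideal P ((?K - {a}) \<union> labels (\<sigma> a))
      (pcomp a (two_term (subst (?\<sigma> A) s) c (subst (?\<sigma> A) t)) (single (\<sigma> a)))"
  proof (rule ideal.comp_left)
    show "single (\<sigma> a) \<in> vecs (labels (\<sigma> a))"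
      using insert.prems(2)[of a] by (intro single_in_vecs) (simp add: mons_def)
    show "a \<in> ?K" using insert.hyps insert.prems(1) by auto
    have "labels (\<sigma> i) \<inter> labels (\<sigma> a) = {}" if "i \<in> A" for i
      using insert.prems(3)[of i a] insert.hyps that by auto
    then show "(?K - {a}) \<inter> labels (\<sigma> a) = {}" using insert.prems(4)[of a] by auto
  qed
  moreover have "(?K - {a}) \<union> labels (\<sigma> a) = (I - insert a A) \<union> (\<Union>i\<in>insert a A. labels (\<sigma> i))"
    using a_fresh insert.prems(4)[of a] by auto
  moreover have "subst (Lf(a := \<sigma> a)) (subst (?\<sigma> A) r) = subst (?\<sigma> (insert a A)) r" for r
  proof -
    have "subst (Lf(a := \<sigma> a)) (\<sigma> i) = \<sigma> i" if "i \<in> A" for i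
      using a_fresh[OF that] by (rule subst_fresh)
    then show ?thesis using insert.hyps unfolding subst_subst by (intro subst_cong) auto
  qed
  ultimately show ?case by (simp add: pcomp_two_term)
qed

text \<open>
  The labels are first shifted out of the way of the labels of all \<open>\<sigma> i\<close>, since
  partial compositions require disjointness at every intermediate step.
\<close>

lemma ideal_subst:
  assumes ideal: "ideal P I (two_term s c t)" and st: "labels s = I" "labels t = I"
    and mult: "\<And>i. i \<in> I \<Longrightarrow> multilinear (\<sigma> i)"
    and disj: "\<And>i j. i \<in> I \<Longrightarrow> j \<in> I \<Longrightarrow> i \<noteq> j \<Longrightarrow> labels (\<sigma> i) \<inter> labels (\<sigma> j) = {}"
  shows "ideal P (labels (subst \<sigma> s)) (two_term (subst \<sigma> s) c (subst \<sigma> t))"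
proof -
  have fin: "finite I" using st finite_labels by auto
  then have "finite (\<Union>i\<in>I. labels (\<sigma> i))" by (simp add: finite_labels)
  then obtain N where N: "\<forall>l\<in>(\<Union>i\<in>I. labels (\<sigma> i)). l < N"
    using finite_nat_set_iff_bounded by blast
  let ?f = "\<lambda>i. i + N" and ?\<tau> = "\<lambda>j. \<sigma> (j - N)"
  have "ideal P (?f ` I) (two_term (subst (\<lambda>i. Lf (?f i)) s) c (subst (\<lambda>i. Lf (?f i)) t))"
    unfolding relabel_two_term[symmetric] by (rule ideal.relabel[OF ideal]) (simp add: inj_on_def)
  then have "ideal P ((?f ` I - ?f ` I) \<union> (\<Union>i\<in>?f ` I. labels (?\<tau> i)))
    (two_term (subst (\<lambda>i. if i \<in> ?f ` I then ?\<tau> i else Lf i) (subst (\<lambda>i. Lf (?f i)) s)) c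
      (subst (\<lambda>i. if i \<in> ?f ` I then ?\<tau> i else Lf i) (subst (\<lambda>i. Lf (?f i)) t)))"
  proof (rule ideal_subst_fresh)
    fix i assume "i \<in> ?f ` I"
    then show "labels (?\<tau> i) \<inter> ?f ` I = {}" using N by force
  next
    fix i j assume "i \<in> ?f ` I" "j \<in> ?f ` I" "i \<noteq> j"
    then show "labels (?\<tau> i) \<inter> labels (?\<tau> j) = {}"
      by (elim imageE) (simp add: disj)
  qed (use st fin mult in \<open>auto simp: labels_subst\<close>)
  moreover have "subst (\<lambda>i. if i \<in> ?f ` I then ?\<tau> i else Lf i) (subst (\<lambda>i. Lf (?f i)) r) = subst \<sigma> r"
    if "labels r = I" for r
    unfolding subst_subst using that by (intro subst_cong) auto
  moreover have "(?f ` I - ?f ` I) \<union> (\<Union>i\<in>?f ` I. labels (?\<tau> i)) = labels (subst \<sigma> s)"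
    using st by (auto simp: labels_subst)
  ultimately show ?thesis using st by simp
qed

section \<open>Rewriting monomials modulo the ideal\<close>

lemma ideal_add: "ideal P I x \<Longrightarrow> ideal P I y \<Longrightarrow> ideal P I (\<lambda>t. x t + y t)"
  using ideal.lin[of P I x y 1] by simp

lemma ideal_scale: "ideal P I x \<Longrightarrow> ideal P I (\<lambda>t. c * x t)"
  using ideal.lin[OF _ ideal.zero, of P I x c] by simp

lemma ideal_two_term_trans:
  assumes "ideal P I (two_term s c t)" "ideal P I (two_term t d r)"
  shows "ideal P I (two_term s (c * d) r)"
  using ideal.lin[OF assms(2,1), of c] by (simp add: two_term_def algebra_simps)

lemma ideal_two_term_sym:
  assumes "ideal P I (two_term s 1 t)"
  shows "ideal P I (two_term t 1 s)"
  using ideal_scale[OF assms, of "- 1"] by (simp add: two_term_def)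

lemma ideal_two_term_context:
  assumes "ideal P J (two_term s c t)" "labels s = J" "labels t = J" "multilinear u" "i \<in> labels u" "(labels u - {i}) \<inter> J = {}"
  shows "ideal P (labels (subst (Lf(i := s)) u)) (two_term (subst (Lf(i := s)) u) c (subst (Lf(i := t)) u))"
proof -
  have "ideal P ((labels u - {i}) \<union> J) (pcomp i (single u) (two_term s c t))"
    using assms by (intro ideal.comp_right single_in_vecs) (auto simp: mons_def)
  moreover have "(labels u - {i}) \<union> J = labels (subst (Lf(i := s)) u)"
    using assms by (auto simp: labels_subst split: if_splits)
  ultimately show ?thesis by (simp add: pcomp_single_two_term)
qed

lemma ideal_swap:
  fixes P :: "(unit, 'k::field) quadratic"
  assumes "multilinear (s \<odot> t)"
  shows "ideal P (labels s \<union> labels t) (two_term (t \<odot> s) (flip_matrix P () ()) (s \<odot> t))"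
proof -
  have "ideal P {1, 2} (two_term (Lf 2 \<odot> Lf 1) (flip_matrix P () ()) (Lf 1 \<odot> Lf 2))"
    using ideal.symm[of P "()"] by (simp add: two_term_def UNIV_unit)
  then have "ideal P (labels (subst (Lf(1 := s, 2 := t)) (Lf 2 \<odot> Lf 1)))
    (two_term (subst (Lf(1 := s, 2 := t)) (Lf 2 \<odot> Lf 1)) (flip_matrix P () ())
      (subst (Lf(1 := s, 2 := t)) (Lf 1 \<odot> Lf 2)))"
    by (rule ideal_subst) (use assms in \<open>auto split: if_splits\<close>)
  then show ?thesis by (simp add: Un_commute)
qed

section \<open>The operad of Jacobi-Jordan algebras and its dual\<close>

text \<open>
  Two graded algebras on \<open>V \<oplus> V' \<oplus> k\<close> with \<open>V = V' = k\<^sup>3\<close>: coordinates 0--2 are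
  the generators, 3--5 the products of two of them, 6 the products of three.  In \<open>jj_alg\<close> the three products
  \<open>(e\<^sub>2 e\<^sub>3) e\<^sub>1\<close>, \<open>(e\<^sub>3 e\<^sub>1) e\<^sub>2\<close>, \<open>(e\<^sub>1 e\<^sub>2) e\<^sub>3\<close> are \<open>- 1, 0, 1\<close>, which sum to 0 as
  the Jacobi identity demands; \<open>skew_alg\<close> is given by cross product and scalar product,
  so that \<open>(u v) w = det(u, v, w)\<close>.
\<close>

definition jj_alg :: "unit \<Rightarrow> (nat \<Rightarrow> 'k::field) \<Rightarrow> (nat \<Rightarrow> 'k) \<Rightarrow> nat \<Rightarrow> 'k" where
  "jj_alg _ u v n =
     (if n = 3 then u 1 * v 2 + u 2 * v 1 else if n = 4 then u 2 * v 0 + u 0 * v 2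
      else if n = 5 then u 0 * v 1 + u 1 * v 0
      else if n = 6 then u 5 * v 2 - u 3 * v 0 + (u 2 * v 5 - u 0 * v 3) else 0)"

definition skew_alg :: "unit \<Rightarrow> (nat \<Rightarrow> 'k::field) \<Rightarrow> (nat \<Rightarrow> 'k) \<Rightarrow> nat \<Rightarrow> 'k" where
  "skew_alg _ u v n =
     (if n = 3 then u 1 * v 2 - u 2 * v 1 else if n = 4 then u 2 * v 0 - u 0 * v 2
      else if n = 5 then u 0 * v 1 - u 1 * v 0
      else if n = 6 then u 3 * v 0 + u 4 * v 1 + u 5 * v 2 - (u 0 * v 3 + u 1 * v 4 + u 2 * v 5) else 0)"

lemma bilinear_jj_alg: "bilinear_ops jj_alg"
  by (simp add: bilinear_ops_def jj_alg_def fun_eq_iff algebra_simps)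

lemma bilinear_skew_alg: "bilinear_ops skew_alg"
  by (simp add: bilinear_ops_def skew_alg_def fun_eq_iff algebra_simps)

lemma combs_unit:
  "combs = {(Lf 1 \<odot> Lf 2) \<odot> Lf 3, (Lf 2 \<odot> Lf 3) \<odot> Lf 1, (Lf 3 \<odot> Lf 1) \<odot> Lf 2}"
  by (auto simp: combs_def)

lemma combs_mons: "combs \<subseteq> (mons {1, 2, 3} :: unit mag set)"
  by (auto simp: combs_unit mons_def)

lemma pairing_JaJo_rel:
  assumes "r \<in> rels (JaJo :: (unit, 'k::field) quadratic)"
  shows "pairing r g = g (Lf 1 \<odot> (Lf 2 \<odot> Lf 3)) + g (Lf 2 \<odot> (Lf 3 \<odot> Lf 1)) + g (Lf 3 \<odot> (Lf 1 \<odot> Lf 2))"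
proof -
  let ?A = "{Lf 1 \<odot> (Lf 2 \<odot> Lf 3), Lf 2 \<odot> (Lf 3 \<odot> Lf 1), Lf 3 \<odot> (Lf 1 \<odot> Lf 2)}"
  have r: "r = (\<lambda>t. single (Lf 1 \<odot> (Lf 2 \<odot> Lf 3)) t + single (Lf 2 \<odot> (Lf 3 \<odot> Lf 1)) t
                 + single (Lf 3 \<odot> (Lf 1 \<odot> Lf 2)) t)"
    using assms by (simp add: JaJo_def)
  have "pairing r g = (\<Sum>t\<in>?A. r t * g t)"
    by (intro pairing_eq_sum) (auto simp: r single_def split: if_splits)
  then show ?thesis by (simp add: r single_def)
qed

lemma rels_JaJo: "rels (JaJo :: (unit, 'k::field) quadratic) \<subseteq> vecs {1, 2, 3}"
  using quadratic_data_JaJo unfolding quadratic_data_def by blast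

lemma rels_dual: "rels (quad_dual JaJo :: (unit, 'k::field) quadratic) \<subseteq> vecs {1, 2, 3}"
  using combs_mons by (auto simp: quad_dual_def perp_def vecs_def)

lemma ideal_JaJo_jj_alg:
  assumes "ideal (JaJo :: (unit, 'k::field) quadratic) I x"
  shows "pairing x (\<lambda>t. ev jj_alg a t j) = 0"
proof (rule ideal_evaluates_to_zero[OF assms rels_JaJo bilinear_jj_alg])
  show "jj_alg e v u = (\<lambda>j. \<Sum>f\<in>UNIV. flip_matrix JaJo e f * jj_alg f u v j)"
    for e and u v :: "nat \<Rightarrow> 'k"
    by (simp add: JaJo_def UNIV_unit jj_alg_def fun_eq_iff algebra_simps)
next
  fix r :: "(unit, 'k) vec" and a :: "nat \<Rightarrow> nat \<Rightarrow> 'k" and j :: nat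
  assume r: "r \<in> rels JaJo"
  show "pairing r (\<lambda>t. ev jj_alg a t j) = 0"
    by (simp add: pairing_JaJo_rel[OF r] jj_alg_def algebra_simps)
qed

text \<open>\<open>perp\<close> tests only against relations supported on \<open>combs\<close>, so
  the Jacobi relation is brought to left-normed form by commutativity before it can constrain the
  dual.\<close>

lemma jacobi_left_normed:
  "ideal (JaJo :: (unit, 'k::field) quadratic) {1, 2, 3}
     (\<lambda>t. single ((Lf 1 \<odot> Lf 2) \<odot> Lf 3) t + single ((Lf 2 \<odot> Lf 3) \<odot> Lf 1) t
        + single ((Lf 3 \<odot> Lf 1) \<odot> Lf 2) t)"
proof -
  let ?P = "JaJo :: (unit, 'k) quadratic"
  have jacobi: "ideal ?P {1, 2, 3} (\<lambda>t. single (Lf 1 \<odot> (Lf 2 \<odot> Lf 3)) t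
      + single (Lf 2 \<odot> (Lf 3 \<odot> Lf 1)) t + single (Lf 3 \<odot> (Lf 1 \<odot> Lf 2)) t)"
    by (rule ideal.rel) (simp add: JaJo_def)
  have swap: "ideal ?P {1, 2, 3} (two_term ((Lf 2 \<odot> Lf 3) \<odot> Lf 1) 1 (Lf 1 \<odot> (Lf 2 \<odot> Lf 3)))"
    "ideal ?P {1, 2, 3} (two_term ((Lf 3 \<odot> Lf 1) \<odot> Lf 2) 1 (Lf 2 \<odot> (Lf 3 \<odot> Lf 1)))"
    "ideal ?P {1, 2, 3} (two_term ((Lf 1 \<odot> Lf 2) \<odot> Lf 3) 1 (Lf 3 \<odot> (Lf 1 \<odot> Lf 2)))"
    using ideal_swap[of "Lf 1" "Lf 2 \<odot> Lf 3" ?P] ideal_swap[of "Lf 2" "Lf 3 \<odot> Lf 1" ?P]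
      ideal_swap[of "Lf 3" "Lf 1 \<odot> Lf 2" ?P]
    by (simp_all add: JaJo_def insert_commute)
  show ?thesis
    using ideal_add[OF ideal_add[OF ideal_add[OF jacobi swap(1)] swap(2)] swap(3)]
    by (simp add: two_term_def algebra_simps)
qed

text \<open>Pairing with the Jacobi relation makes the coefficients of each \<open>r\<close> in
  \<open>perp JaJo\<close> sum to zero, and the three monomials of \<open>combs\<close> have the
  same value in \<open>skew_alg\<close>, since the determinant is invariant under cyclic
  permutation.\<close>

lemma ideal_dual_skew_alg:
  assumes "ideal (quad_dual JaJo :: (unit, 'k::field) quadratic) I x"
  shows "pairing x (\<lambda>t. ev skew_alg a t j) = 0"
proof (rule ideal_evaluates_to_zero[OF assms rels_dual bilinear_skew_alg])
  show "skew_alg e v u = (\<lambda>j. \<Sum>f\<in>UNIV. flip_matrix (quad_dual JaJo) e f * skew_alg f u v j)"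
    for e and u v :: "nat \<Rightarrow> 'k"
    by (simp add: quad_dual_def JaJo_def UNIV_unit skew_alg_def fun_eq_iff algebra_simps)
next
  fix r :: "(unit, 'k) vec" and a :: "nat \<Rightarrow> nat \<Rightarrow> 'k" and j :: nat
  assume "r \<in> rels (quad_dual JaJo)"
  then have r: "r \<in> perp JaJo" by (simp add: quad_dual_def)
  let ?x = "\<lambda>t. single ((Lf 1 \<odot> Lf 2) \<odot> Lf 3) t + single ((Lf 2 \<odot> Lf 3) \<odot> Lf 1) t
        + single ((Lf 3 \<odot> Lf 1) \<odot> Lf 2) t :: 'k"
  have "(\<Sum>t\<in>combs. r t * ?x t) = 0"
  proof -
    have "\<forall>t. ?x t \<noteq> 0 \<longrightarrow> t \<in> combs" by (auto simp: combs_unit single_def split: if_splits)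
    then show ?thesis using r jacobi_left_normed[where 'k = 'k] unfolding perp_def by blast
  qed
  then have sum: "r ((Lf 1 \<odot> Lf 2) \<odot> Lf 3) + r ((Lf 2 \<odot> Lf 3) \<odot> Lf 1) + r ((Lf 3 \<odot> Lf 1) \<odot> Lf 2) = 0"
    by (simp add: combs_unit single_def add.assoc)
  let ?d = "ev skew_alg a ((Lf 1 \<odot> Lf 2) \<odot> Lf 3) j"
  have "pairing r (\<lambda>t. ev skew_alg a t j) = (\<Sum>t\<in>combs. r t * ev skew_alg a t j)"
    using r by (intro pairing_eq_sum) (auto simp: perp_def combs_unit)
  also have "\<dots> = (\<Sum>t\<in>combs. r t * ?d)"
    by (intro sum.cong) (auto simp: combs_unit skew_alg_def algebra_simps)
  also have "\<dots> = (r ((Lf 1 \<odot> Lf 2) \<odot> Lf 3) + r ((Lf 2 \<odot> Lf 3) \<odot> Lf 1) + r ((Lf 3 \<odot> Lf 1) \<odot> Lf 2)) * ?d"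
    by (simp add: combs_unit distrib_right add.assoc)
  finally show "pairing r (\<lambda>t. ev skew_alg a t j) = 0" by (simp only: sum mult_zero_left)
qed

section \<open>Relations of the dual operad up to arity four\<close>

lemma ideal_dual_swap:
  assumes "multilinear (s \<odot> t)"
  shows "ideal (quad_dual JaJo :: (unit, 'k::field) quadratic) (labels (t \<odot> s)) (two_term (t \<odot> s) (- 1) (s \<odot> t))"
  using ideal_swap[OF assms, of "quad_dual JaJo"] by (simp add: quad_dual_def JaJo_def Un_commute)

lemma cyclic_in_perp:
  "two_term ((Lf 1 \<odot> Lf 2) \<odot> Lf 3) 1 ((Lf 2 \<odot> Lf 3) \<odot> Lf 1) \<in> perp (JaJo :: (unit, 'k::field) quadratic)"
  (is "two_term ?s 1 ?t \<in> _")
proof -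
  have "(\<Sum>t\<in>combs. two_term ?s 1 ?t t * r t) = 0"
    if r: "ideal JaJo {1, 2, 3} r" "\<forall>t. r t \<noteq> 0 \<longrightarrow> t \<in> combs" for r :: "(unit, 'k) vec"
  proof -
    \<comment> \<open>Labels 1, 2, 3 go to the generators 0, 1, 2 of \<open>jj_alg\<close>.
      Coordinate 6 of the three monomials of \<open>combs\<close> is then 1, -1, 0, so evaluating
      \<open>r\<close> there is the same as pairing it with the vector in question.\<close>
    let ?a = "\<lambda>i j. if i = j + 1 then 1 else 0 :: 'k"
    have "(\<Sum>t\<in>combs. r t * ev jj_alg ?a t 6) = pairing r (\<lambda>t. ev jj_alg ?a t 6)"
      using r(2) by (intro pairing_eq_sum[symmetric]) (auto simp: combs_unit)
    also have "\<dots> = 0" using r(1) by (rule ideal_JaJo_jj_alg)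
    finally have "r ?s - r ?t = 0" by (simp add: combs_unit jj_alg_def)
    then show ?thesis by (simp add: combs_unit two_term_def single_def)
  qed
  moreover have "\<forall>u. two_term ?s 1 ?t u \<noteq> 0 \<longrightarrow> u \<in> combs"
    using two_term_nonzero[of ?s 1 ?t] by (auto simp: combs_unit)
  ultimately show ?thesis by (simp add: perp_def)
qed

lemma ideal_dual_cyclic:
  assumes "multilinear ((s \<odot> t) \<odot> u)"
  shows "ideal (quad_dual JaJo :: (unit, 'k::field) quadratic) (labels s \<union> labels t \<union> labels u)
    (two_term ((s \<odot> t) \<odot> u) 1 ((t \<odot> u) \<odot> s))"
proof -
  let ?\<sigma> = "Lf(1 := s, 2 := t, 3 := u)"
  have "ideal (quad_dual JaJo :: (unit, 'k) quadratic) {1, 2, 3}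
      (two_term ((Lf 1 \<odot> Lf 2) \<odot> Lf 3) 1 ((Lf 2 \<odot> Lf 3) \<odot> Lf 1))"
    by (rule ideal.rel) (simp add: quad_dual_def cyclic_in_perp[simplified])
  then have "ideal (quad_dual JaJo) (labels (subst ?\<sigma> ((Lf 1 \<odot> Lf 2) \<odot> Lf 3)))
      (two_term (subst ?\<sigma> ((Lf 1 \<odot> Lf 2) \<odot> Lf 3)) (1 :: 'k) (subst ?\<sigma> ((Lf 2 \<odot> Lf 3) \<odot> Lf 1)))"
    by (rule ideal_subst) (use assms in \<open>auto split: if_splits\<close>)
  then show ?thesis by simp
qed

lemma ideal_two_term_mult:
  assumes "ideal (P :: (unit, 'k::field) quadratic) (labels s) (two_term s c t)" "labels t = labels s" "l \<notin> labels s"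
  shows "ideal P (labels (s \<odot> Lf l)) (two_term (s \<odot> Lf l) c (t \<odot> Lf l))"
  \<comment> \<open>The label \<open>Suc l\<close> only marks the hole; it may also occur in
    \<open>s\<close>, because substitution removes it from the context.\<close>
  using ideal_two_term_context[OF assms(1) refl assms(2), of "Lf (Suc l) \<odot> Lf l" "Suc l"] assms(3)
  by (simp add: insert_Diff_if)

text \<open>The chain leads the monomial back to itself through three sign changes, whence w = -w;
  dividing by 2 uses the characteristic.\<close>

lemma ideal_dual_arity_four:
  "ideal (quad_dual JaJo :: (unit, 'k::field_char_0) quadratic) {1, 2, 3, 4}
     (single (((Lf 1 \<odot> Lf 2) \<odot> Lf 3) \<odot> Lf 4))"
proof -
  let ?Q = "quad_dual JaJo :: (unit, 'k) quadratic"
  define rel where "rel s c t = ideal ?Q {1, 2, 3, 4} (two_term s c t)" for s t c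
  have trans [trans]: "rel s c t \<Longrightarrow> rel t d u \<Longrightarrow> rel s (c * d) u" for s t u c d
    unfolding rel_def by (rule ideal_two_term_trans)
  let ?w = "\<lambda>i j k l. ((Lf i \<odot> Lf j) \<odot> Lf k) \<odot> Lf l"
  have cyclic: "rel (?w i j k l) 1 (?w j k i l)"
    if "distinct [i, j, k, l]" "{i, j, k, l} = {1, 2, 3, 4}" for i j k l
    using ideal_two_term_mult[of ?Q "(Lf i \<odot> Lf j) \<odot> Lf k" 1 "(Lf j \<odot> Lf k) \<odot> Lf i" l]
      ideal_dual_cyclic[of "Lf i" "Lf j" "Lf k"] that
    by (auto simp: rel_def insert_commute Un_commute)
  have cyclic_outer: "rel ((s \<odot> t) \<odot> u) 1 ((t \<odot> u) \<odot> s)"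
    if "multilinear ((s \<odot> t) \<odot> u)" "labels s \<union> labels t \<union> labels u = {1, 2, 3, 4}" for s t u
    using ideal_dual_cyclic[OF that(1)] that(2) by (simp add: rel_def)
  have "rel (?w 1 2 3 4) 1 ((Lf 3 \<odot> Lf 4) \<odot> (Lf 1 \<odot> Lf 2))"
    by (rule cyclic_outer) auto
  also have "rel \<dots> (- 1) ((Lf 1 \<odot> Lf 2) \<odot> (Lf 3 \<odot> Lf 4))"
    using ideal_dual_swap[of "Lf 1 \<odot> Lf 2" "Lf 3 \<odot> Lf 4"] by (simp add: rel_def insert_commute)
  \<comment> \<open>The cyclic relation read backwards, with \<open>Lf 3 \<odot> Lf 4\<close> as its
    first argument.\<close>
  also have "rel \<dots> 1 (?w 3 4 1 2)"
    unfolding rel_def by (rule ideal_two_term_sym, fold rel_def, rule cyclic_outer) auto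
  also have "rel \<dots> 1 (?w 4 1 3 2)"
    by (rule cyclic) auto
  also have "rel \<dots> 1 (?w 1 3 4 2)"
    by (rule cyclic) auto
  also have "rel \<dots> 1 ((Lf 4 \<odot> Lf 2) \<odot> (Lf 1 \<odot> Lf 3))"
    by (rule cyclic_outer) auto
  \<comment> \<open>The block \<open>Lf 1 \<odot> Lf 3\<close> now serves as third argument, which
    returns the letter 4 to the outermost place.\<close>
  also have "rel \<dots> 1 ((Lf 2 \<odot> (Lf 1 \<odot> Lf 3)) \<odot> Lf 4)"
    by (rule cyclic_outer) auto
  also have "rel \<dots> (- 1) (?w 1 3 2 4)"
    using ideal_two_term_mult[OF ideal_dual_swap[of "Lf 1 \<odot> Lf 3" "Lf 2", where 'k = 'k], of 4]
    by (simp add: rel_def insert_commute)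
  also have "rel \<dots> 1 (?w 3 2 1 4)"
    by (rule cyclic) auto
  also have "rel \<dots> 1 (?w 2 1 3 4)"
    by (rule cyclic) auto
  also have "rel \<dots> (- 1) (?w 1 2 3 4)"
    using ideal_two_term_mult[OF ideal_two_term_mult[OF ideal_dual_swap[of "Lf 1" "Lf 2", where 'k = 'k], of 3], of 4]
    by (simp add: rel_def insert_commute)
  finally have "ideal ?Q {1, 2, 3, 4} (two_term (?w 1 2 3 4) (- 1) (?w 1 2 3 4))"
    by (simp add: rel_def)
  from ideal_scale[OF this, of "1 / 2"] show ?thesis by (simp add: two_term_def)
qed

section \<open>The sign functionals on the vertices\<close>

definition order_sign :: "nat \<Rightarrow> nat \<Rightarrow> int" where
  "order_sign i j = (if i < j then 1 else if j < i then - 1 else 0)"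

text \<open>The sign of composition in the sign operad, see \<open>vertex_fun_pcomp\<close>; meaningful for two-element sets only.\<close>

definition glue_sign :: "nat set \<Rightarrow> nat \<Rightarrow> nat set \<Rightarrow> int" where
  "glue_sign I i J = (let k = Min J; l = Max J in
     if i = Min I then order_sign k l * order_sign k (Max I) * order_sign l (Max I)
     else - (order_sign k l * order_sign k (Min I) * order_sign l (Min I)))"

text \<open>Numbering basis vectors by rank makes the functionals depend on the order of the labels
  and not on their values.\<close>

definition rank_basis :: "nat set \<Rightarrow> nat \<Rightarrow> nat \<Rightarrow> 'k::field" where
  "rank_basis I l n = (if l \<in> I \<and> n = card {m \<in> I. m < l} then 1 else 0)"

text \<open>
  A generator of the dual of \<open>Q(I)\<close> when \<open>I\<close> has two or three elements: the
  product of all labels of \<open>I\<close> in increasing order lies in coordinate 5, respectively 6.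
\<close>

definition vertex_fun :: "nat set \<Rightarrow> (unit, 'k::field) vec \<Rightarrow> 'k" where
  "vertex_fun I x = pairing x (\<lambda>t. ev skew_alg (rank_basis I) t (card I + 3))"

lemma vertex_fun_ideal: "ideal (quad_dual JaJo) I x \<Longrightarrow> vertex_fun K x = 0"
  unfolding vertex_fun_def by (rule ideal_dual_skew_alg)

lemma vertex_fun_lin:
  assumes "x \<in> vecs I" "y \<in> vecs I"
  shows "vertex_fun K (\<lambda>t. c * x t + y t) = c * vertex_fun K x + vertex_fun K y"
  unfolding vertex_fun_def by (rule pairing_lin[OF assms])

section \<open>Values of the sign functionals in arities two and three\<close>

lemma mons_singleton: "mons {i} = {Lf i :: unit mag}"
proof -
  have "t = Lf i" if t: "t \<in> mons {i}" for t :: "unit mag"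
  proof (cases t)
    case (Op e l r)
    have "labels l \<inter> labels r = {}" "labels l \<subseteq> {i}" "labels r \<subseteq> {i}" using t Op by (auto simp: mons_def)
    then show ?thesis using labels_nonempty[of l] labels_nonempty[of r] by blast
  qed (use t in \<open>auto simp: mons_def\<close>)
  then show ?thesis by (auto simp: mons_def)
qed

lemma mons_pair:
  assumes "i \<noteq> j"
  shows "mons {i, j} = {Lf i \<odot> Lf j, Lf j \<odot> Lf i}"
proof -
  have "t \<in> {Lf i \<odot> Lf j, Lf j \<odot> Lf i}" if t: "t \<in> mons {i, j}" for t :: "unit mag"
  proof (cases t)
    case (Op e l r)
    have disj: "labels l \<inter> labels r = {}" and un: "labels l \<union> labels r = {i, j}"
      and m: "multilinear l" "multilinear r" using t Op by (auto simp: mons_def)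
    have "labels l = {i} \<and> labels r = {j} \<or> labels l = {j} \<and> labels r = {i}"
    proof (cases "i \<in> labels l")
      case True
      then have "labels r \<subseteq> {j}" using disj un by auto
      then have "labels r = {j}" using labels_nonempty[of r] by blast
      then show ?thesis using True disj un assms by auto
    next
      case False
      then have "labels l \<subseteq> {j}" using un by auto
      then have "labels l = {j}" using labels_nonempty[of l] by blast
      then show ?thesis using False disj un assms by auto
    qed
    then have "l \<in> mons {i} \<and> r \<in> mons {j} \<or> l \<in> mons {j} \<and> r \<in> mons {i}"
      using m by (auto simp: mons_def)
    then show ?thesis using Op by (auto simp: mons_singleton)
  qed (use t assms in \<open>auto simp: mons_def\<close>)
  then show ?thesis using assms by (auto simp: mons_def)
qed

lemma pairing_pair:
  assumes "x \<in> vecs {i, j}" "i \<noteq> j"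
  shows "pairing x g = x (Lf i \<odot> Lf j) * g (Lf i \<odot> Lf j) + x (Lf j \<odot> Lf i) * g (Lf j \<odot> Lf i)"
  using assms by (simp add: pairing_vecs[of _ "{i, j}"] mons_pair)

lemma card_below:
  fixes j k l :: nat
  assumes "k \<noteq> l"
  shows "card {m \<in> {j, k, l}. m < j} = (if k < j then 1 else 0) + (if l < j then 1 else 0)"
proof -
  have "{m \<in> {j, k, l}. m < j} = (if k < j then {k} else {}) \<union> (if l < j then {l} else {})" by auto
  then show ?thesis using assms by simp
qed

lemma vertex_fun_pair:
  assumes "x \<in> vecs {i, j}" "i \<noteq> j"
  shows "vertex_fun {i, j} x = of_int (order_sign i j) * (x (Lf i \<odot> Lf j) - x (Lf j \<odot> Lf i))"
proof -
  have "{m. (m = i \<or> m = j) \<and> m < i} = (if j < i then {j} else {})"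
    "{m. (m = i \<or> m = j) \<and> m < j} = (if i < j then {i} else {})" by auto
  then show ?thesis using assms
    by (auto simp: vertex_fun_def pairing_pair skew_alg_def rank_basis_def order_sign_def algebra_simps)
qed

text \<open>The determinant of a permuted standard basis is the sign of the permutation, here one
  comparison for each pair of the sequence \<open>k\<close>, \<open>l\<close>,
  \<open>j\<close>.\<close>

lemma det_rank_basis:
  assumes "distinct [j, k, l]" "K = {j, k, l}"
  shows "skew_alg () (skew_alg () (rank_basis K k) (rank_basis K l)) (rank_basis K j) 6 =
    of_int (order_sign k l * order_sign k j * order_sign l j)"
proof -
  have *: "rank_basis K j n = (if n = (if k < j then 1 else 0) + (if l < j then 1 else 0) then 1 else 0)"
    "rank_basis K k n = (if n = (if j < k then 1 else 0) + (if l < k then 1 else 0) then 1 else 0)"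
    "rank_basis K l n = (if n = (if j < l then 1 else 0) + (if k < l then 1 else 0) then 1 else 0)" for n
    using card_below[of k l j] card_below[of j l k] card_below[of j k l] assms
    by (simp_all add: rank_basis_def insert_commute)
  from assms(1) consider "j < k" "k < l" | "j < l" "l < k" | "k < j" "j < l" | "k < l" "l < j" | "l < j" "j < k" | "l < k" "k < j"
    by (auto simp: neq_iff)
  then show ?thesis
    by cases (simp_all add: skew_alg_def * order_sign_def)
qed

text \<open>Exchanging the two factors at either vertex negates the value in
  \<open>skew_alg\<close>, so the pairing splits into the antisymmetrised coefficients of
  \<open>x\<close> and \<open>y\<close> times one determinant. This is what turns the cobar
  differential into integer signs.\<close>

lemma vertex_fun_pcomp:
  assumes I: "card I = 2" "i \<in> I" and J: "card J = 2" and disj: "(I - {i}) \<inter> J = {}"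
    and x: "x \<in> vecs I" and y: "y \<in> vecs J"
  shows "vertex_fun ((I - {i}) \<union> J) (pcomp i x y) =
    of_int (glue_sign I i J) * vertex_fun I x * vertex_fun J y"
proof -
  obtain j where j: "I = {i, j}" "i \<noteq> j" using I by (auto simp: card_2_iff)
  obtain k l where kl: "J = {k, l}" "k < l"
    using J by (auto simp: card_2_iff neq_iff insert_commute)
  let ?K = "(I - {i}) \<union> J"
  have K: "?K = {j, k, l}" and dist: "distinct [j, k, l]" using j kl disj by auto
  let ?a = "rank_basis ?K :: nat \<Rightarrow> nat \<Rightarrow> 'a"
  let ?d = "skew_alg () (skew_alg () (?a k) (?a l)) (?a j) 6"
  let ?e = "\<lambda>t u. ev skew_alg ?a (subst (Lf(i := u)) t) (card ?K + 3)"
  have "card ?K = 3" using dist unfolding K by simp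
  then have e: "?e (Lf i \<odot> Lf j) (Lf k \<odot> Lf l) = ?d" "?e (Lf i \<odot> Lf j) (Lf l \<odot> Lf k) = - ?d"
    "?e (Lf j \<odot> Lf i) (Lf k \<odot> Lf l) = - ?d" "?e (Lf j \<odot> Lf i) (Lf l \<odot> Lf k) = ?d"
    using j(2) by (simp_all add: skew_alg_def algebra_simps)
  have px: "pairing x g = x (Lf i \<odot> Lf j) * g (Lf i \<odot> Lf j) + x (Lf j \<odot> Lf i) * g (Lf j \<odot> Lf i)" for g
    using x j by (intro pairing_pair) simp_all
  have py: "pairing y g = y (Lf k \<odot> Lf l) * g (Lf k \<odot> Lf l) + y (Lf l \<odot> Lf k) * g (Lf l \<odot> Lf k)" for g
    using y kl by (intro pairing_pair) simp_all
  have "vertex_fun ?K (pcomp i x y) = pairing x (\<lambda>t. pairing y (?e t))"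
    unfolding vertex_fun_def by (rule pairing_pcomp[OF finite_support[OF x] finite_support[OF y]])
  also have "\<dots> = ?d * (x (Lf i \<odot> Lf j) - x (Lf j \<odot> Lf i)) * (y (Lf k \<odot> Lf l) - y (Lf l \<odot> Lf k))"
    unfolding px py e by (simp add: algebra_simps)
  also have "?d = of_int (order_sign k l * order_sign k j * order_sign l j)"
    using dist K by (rule det_rank_basis)
  finally show ?thesis
    using j kl x y by (auto simp: vertex_fun_pair glue_sign_def order_sign_def Let_def min_def max_def)
qed

section \<open>Contraction of edges in trees\<close>

lemma finite_tree: "T \<in> trees n \<Longrightarrow> finite T"
  by (rule finite_subset[of _ "Pow {1..n}"]) (auto simp: trees_def)

lemma finite_vertex: "T \<in> trees n \<Longrightarrow> v \<in> T \<Longrightarrow> finite v"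
  using finite_subset[of v "{1..n}"] by (auto simp: trees_def)

lemma tree_nonempty: "T \<in> trees n \<Longrightarrow> {} \<notin> T"
  by (auto simp: trees_def)

lemma tree_singleton: "T \<in> trees n \<Longrightarrow> {i} \<notin> T"
  by (auto simp: trees_def)

lemma tree_laminar: "T \<in> trees n \<Longrightarrow> v \<in> T \<Longrightarrow> w \<in> T \<Longrightarrow> v \<subseteq> w \<or> w \<subseteq> v \<or> v \<inter> w = {}"
  unfolding trees_def by blast

text \<open>The vertices properly containing \<open>e\<close> pairwise intersect, so laminarity
  makes them a chain, nonempty because of the root. Its minimal member lies in all others and equals
  the intersection defining \<open>parent\<close>.\<close>

lemma parent_props:
  assumes T: "T \<in> trees n" and e: "e \<in> T" "e \<noteq> {1..n}"
  shows "parent T e \<in> T" "e \<subset> parent T e" "\<And>q. q \<in> T \<Longrightarrow> e \<subset> q \<Longrightarrow> parent T e \<subseteq> q"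
proof -
  let ?S = "{p \<in> T. e \<subset> p}"
  have "e \<subseteq> {1..n}" "2 \<le> card e" using T e by (auto simp: trees_def)
  then have "2 \<le> n" using card_mono[of "{1..n}" e] by simp
  then have "{1..n} \<in> ?S" using T e by (auto simp: trees_def)
  moreover have "finite ?S" using finite_tree[OF T] by simp
  ultimately have "\<exists>m\<in>?S. \<forall>b\<in>?S. b \<subseteq> m \<longrightarrow> m = b"
    by (intro finite_has_minimal) auto
  then obtain m where m: "m \<in> ?S" and min: "\<forall>b\<in>?S. b \<subseteq> m \<longrightarrow> m = b"
    by (rule bexE)
  have le: "m \<subseteq> q" if "q \<in> ?S" for q
  proof -
    have "e \<noteq> {}" using tree_nonempty[OF T] e by auto
    then have "m \<inter> q \<noteq> {}" using m that by blast
    then have "m \<subseteq> q \<or> q \<subseteq> m" using tree_laminar[OF T] m that by blast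
    then show ?thesis using min that by blast
  qed
  have "parent T e = m" unfolding parent_def using m le by blast
  then show "parent T e \<in> T" "e \<subset> parent T e" "\<And>q. q \<in> T \<Longrightarrow> e \<subset> q \<Longrightarrow> parent T e \<subseteq> q"
    using m le by auto
qed

section \<open>Children and inputs under contraction of an edge\<close>

lemma childrenD:
  assumes "c \<in> children T v"
  shows "c \<in> T \<or> (\<exists>i. c = {i})" "c \<subset> v" "\<And>d. d \<in> T \<Longrightarrow> c \<subset> d \<Longrightarrow> d \<subset> v \<Longrightarrow> False"
  using assms unfolding children_def by blast+

lemma childrenI:
  assumes "c \<in> T \<or> (\<exists>i. c = {i})" "c \<subset> v" "\<And>d. d \<in> T \<Longrightarrow> c \<subset> d \<Longrightarrow> d \<subset> v \<Longrightarrow> False"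
  shows "c \<in> children T v"
  using assms unfolding children_def by blast

lemma children_nonempty: "T \<in> trees n \<Longrightarrow> c \<in> children T v \<Longrightarrow> c \<noteq> {}"
  using tree_nonempty[of T n] childrenD(1)[of c T v] by blast

lemma children_disjoint:
  assumes T: "T \<in> trees n" and c: "c \<in> children T v" and d: "d \<in> children T v" and "c \<noteq> d"
  shows "c \<inter> d = {}"
proof -
  have no: "\<not> c \<subset> d" if "c \<in> children T v" "d \<in> children T v" for c d
  proof
    assume "c \<subset> d"
    moreover have "c \<noteq> {}" using children_nonempty[OF T that(1)] .
    ultimately have "d \<in> T" using childrenD(1)[OF that(2)] by blast
    then show False using childrenD(3)[OF that(1)] childrenD(2)[OF that(2)] \<open>c \<subset> d\<close> by blast
  qed
  have "c \<subseteq> d \<or> d \<subseteq> c \<or> c \<inter> d = {}"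
    using childrenD(1)[OF c] childrenD(1)[OF d] tree_laminar[OF T] by blast
  then show ?thesis using no[OF c d] no[OF d c] \<open>c \<noteq> d\<close> by blast
qed

lemma child_of_parent:
  assumes "T \<in> trees n" "e \<in> T" "e \<noteq> {1..n}"
  shows "e \<in> children T (parent T e)"
  using parent_props[OF assms] assms by (intro childrenI) blast+

text \<open>The delicate point is that children of \<open>e\<close> become children of its parent: a
  vertex strictly in between meets \<open>e\<close>, so laminarity places it inside \<open>e\<close>
  or above \<open>e\<close>. The first contradicts being a child, the second the minimality of the
  parent.\<close>

lemma children_contract_parent:
  assumes T: "T \<in> trees n" and e: "e \<in> T" "e \<noteq> {1..n}"
  shows "children (T - {e}) (parent T e) = (children T (parent T e) - {e}) \<union> children T e"
proof -
  note p = parent_props[OF T e]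
  have "c \<in> (children T (parent T e) - {e}) \<union> children T e" if c: "c \<in> children (T - {e}) (parent T e)" for c
  proof (cases "c \<subset> e")
    case True
    have "c \<in> children T e"
    proof (rule childrenI)
      show "c \<in> T \<or> (\<exists>i. c = {i})" using childrenD(1)[OF c] by blast
      fix d assume "d \<in> T" "c \<subset> d" "d \<subset> e"
      then show False using childrenD(3)[OF c, of d] psubset_trans[OF _ p(2), of d] by auto
    qed (rule True)
    then show ?thesis by blast
  next
    case False
    have "c \<noteq> e" using childrenD(1)[OF c] tree_singleton[OF T] e(1) by blast
    moreover have "c \<in> children T (parent T e)"
    proof (rule childrenI)
      show "c \<in> T \<or> (\<exists>i. c = {i})" using childrenD(1)[OF c] by blast
      fix d assume "d \<in> T" "c \<subset> d" "d \<subset> parent T e"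
      then show False using childrenD(3)[OF c, of d] False by auto
    qed (rule childrenD(2)[OF c])
    ultimately show ?thesis by blast
  qed
  moreover have "c \<in> children (T - {e}) (parent T e)" if c: "c \<in> children T (parent T e)" "c \<noteq> e" for c
  proof (rule childrenI)
    show "c \<in> T - {e} \<or> (\<exists>i. c = {i})" using childrenD(1)[OF c(1)] c(2) by blast
    fix d assume "d \<in> T - {e}" "c \<subset> d" "d \<subset> parent T e"
    then show False using childrenD(3)[OF c(1), of d] by simp
  qed (rule childrenD(2)[OF c(1)])
  moreover have "c \<in> children (T - {e}) (parent T e)" if c: "c \<in> children T e" for c
  proof (rule childrenI)
    show "c \<in> T - {e} \<or> (\<exists>i. c = {i})" using childrenD(1,2)[OF c] by blast
    show "c \<subset> parent T e" using childrenD(2)[OF c] p(2) by (rule psubset_trans)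
    fix d assume d: "d \<in> T - {e}" "c \<subset> d" "d \<subset> parent T e"
    have "d \<inter> e \<noteq> {}" using children_nonempty[OF T c] childrenD(2)[OF c] d(2) by blast
    then consider "d \<subset> e" | "e \<subset> d" using tree_laminar[OF T, of d e] d(1) e(1) by auto
    then show False
    proof cases
      case 1 then show False using childrenD(3)[OF c, of d] d by auto
    next
      case 2 then show False using p(3)[of d] d by auto
    qed
  qed
  ultimately show ?thesis by blast
qed

text \<open>If \<open>e\<close> lies strictly between \<open>c\<close> and \<open>v\<close>, then so
  does its parent, which survives the contraction; hence removing \<open>e\<close> unblocks nothing.
  Conversely, \<open>e\<close> itself is no child of \<open>v\<close>.\<close>

lemma children_contract_other:
  assumes T: "T \<in> trees n" and e: "e \<in> T" "e \<noteq> {1..n}" and v: "v \<in> T" "v \<noteq> parent T e"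
  shows "children (T - {e}) v = children T v"
proof -
  note p = parent_props[OF T e]
  have pv: "parent T e \<subset> v" if "e \<subset> v" using p(3)[OF v(1) that] v(2) by blast
  have "c \<in> children T v" if c: "c \<in> children (T - {e}) v" for c
  proof (rule childrenI)
    show "c \<in> T \<or> (\<exists>i. c = {i})" "c \<subset> v" using childrenD(1,2)[OF c] by blast+
    fix d assume d: "d \<in> T" "c \<subset> d" "d \<subset> v"
    show False
    proof (cases "d = e")
      case True
      then have "parent T e \<subset> v" "c \<subset> parent T e" "parent T e \<noteq> e"
        using pv p(2) d psubset_trans[OF _ p(2), of c] by auto
      then show False using childrenD(3)[OF c, of "parent T e"] p(1) by simp
    qed (use childrenD(3)[OF c, of d] d in simp)
  qed
  moreover have "c \<in> children (T - {e}) v" if c: "c \<in> children T v" for c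
  proof (rule childrenI)
    have "c \<noteq> e" using childrenD(2)[OF c] childrenD(3)[OF c p(1)] pv p(2) by auto
    then show "c \<in> T - {e} \<or> (\<exists>i. c = {i})" using childrenD(1)[OF c] by blast
    fix d assume "d \<in> T - {e}" "c \<subset> d" "d \<subset> v"
    then show False using childrenD(3)[OF c, of d] by simp
  qed (rule childrenD(2)[OF c])
  ultimately show ?thesis by blast
qed

lemma Min_child:
  assumes "T \<in> trees n" "v \<in> T" "c \<in> children T v"
  shows "Min c \<in> c"
  using finite_vertex[OF assms(1,2)] childrenD(2)[OF assms(3)] children_nonempty[OF assms(1,3)]
  by (intro Min_in) (auto intro: finite_subset)

lemma inputs_contract_other:
  assumes "T \<in> trees n" "e \<in> T" "e \<noteq> {1..n}" "v \<in> T" "v \<noteq> parent T e"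
  shows "inputs (T - {e}) v = inputs T v"
  using children_contract_other[OF assms] by (simp add: inputs_def)

text \<open>Children of one vertex are disjoint, so their least leaves are distinct. The three
  claims are the label conditions under which \<open>pcomp (Min e)\<close> composes the decorations
  of the merged vertices.\<close>

lemma inputs_contract_parent:
  assumes T: "T \<in> trees n" and e: "e \<in> T" "e \<noteq> {1..n}"
  shows "inputs (T - {e}) (parent T e) = (inputs T (parent T e) - {Min e}) \<union> inputs T e"
    and "(inputs T (parent T e) - {Min e}) \<inter> inputs T e = {}"
    and "Min e \<in> inputs T (parent T e)"
proof -
  let ?p = "parent T e"
  note p = parent_props[OF T e]
  note ec = child_of_parent[OF T e]
  have "inj_on Min (children T ?p)"
  proof (rule inj_onI)
    fix c d assume cd: "c \<in> children T ?p" "d \<in> children T ?p" "Min c = Min d"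
    then show "c = d"
      using children_disjoint[OF T cd(1,2)] Min_child[OF T p(1) cd(1)] Min_child[OF T p(1) cd(2)] by auto
  qed
  then have diff: "Min ` (children T ?p - {e}) = inputs T ?p - {Min e}"
    using ec by (simp add: inputs_def inj_on_image_set_diff[of Min "children T ?p"])
  then show "inputs (T - {e}) ?p = (inputs T ?p - {Min e}) \<union> inputs T e"
    by (simp add: inputs_def children_contract_parent[OF T e] image_Un)
  show "(inputs T ?p - {Min e}) \<inter> inputs T e = {}"
  proof -
    have "Min ` (children T ?p - {e}) \<subseteq> - e"
    proof (rule image_subsetI)
      fix c assume "c \<in> children T ?p - {e}"
      then show "Min c \<in> - e"
        using children_disjoint[OF T _ ec, of c] Min_child[OF T p(1), of c] by auto
    qed
    moreover have "Min ` children T e \<subseteq> e"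
    proof (rule image_subsetI)
      fix c assume "c \<in> children T e"
      then show "Min c \<in> e" using Min_child[OF T e(1)] childrenD(2)[of c T e] by auto
    qed
    ultimately show ?thesis unfolding diff[symmetric] by (simp add: inputs_def[of T e]) blast
  qed
  show "Min e \<in> inputs T ?p" using ec by (simp add: inputs_def)
qed

lemma contract_in_decs:
  assumes T: "T \<in> trees n" and e: "e \<in> T" "e \<noteq> {1..n}" and x: "x \<in> decs T"
  shows "contract T e x \<in> decs (T - {e})"
proof -
  have "x v \<in> vecs (inputs T v)" if "v \<in> T" for v using x that by (auto simp: decs_def)
  note xv = this
  have "(x(parent T e := pcomp (Min e) (x (parent T e)) (x e))) v \<in> vecs (inputs (T - {e}) v)"
    if v: "v \<in> T - {e}" for v
  proof (cases "v = parent T e")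
    case True
    have "pcomp (Min e) (x (parent T e)) (x e) \<in> vecs ((inputs T (parent T e) - {Min e}) \<union> inputs T e)"
      by (rule pcomp_in_vecs[OF xv xv inputs_contract_parent(3,2)[OF T e]])
        (use parent_props(1)[OF T e] e(1) in auto)
    then show ?thesis by (simp add: True inputs_contract_parent(1)[OF T e])
  next
    case False
    then show ?thesis using xv v inputs_contract_other[OF T e, of v] by simp
  qed
  then show ?thesis by (simp add: decs_def contract_def)
qed

lemma tree_remove: "T \<in> trees n \<Longrightarrow> e \<noteq> {1..n} \<Longrightarrow> T - {e} \<in> trees n"
  by (auto simp: trees_def)

section \<open>A cocycle in arity five\<close>

text \<open>
  All possible vertices other than the root, ordered by \<^const>\<open>set_encode\<close>, as in \<open>Det(T)\<close>.
\<close>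

definition vertex_sets :: "nat list list" where
  "vertex_sets = [[1, 2], [1, 3], [2, 3], [1, 2, 3], [1, 4], [2, 4], [1, 2, 4], [3, 4], [1, 3, 4], [2, 3, 4],
[1, 2, 3, 4], [1, 5], [2, 5], [1, 2, 5], [3, 5], [1, 3, 5], [2, 3, 5], [1, 2, 3, 5], [4, 5],
[1, 4, 5], [2, 4, 5], [1, 2, 4, 5], [3, 4, 5], [1, 3, 4, 5], [2, 3, 4, 5]]"

text \<open>
  An entry \<open>(a, b, s)\<close> is the value \<open>s\<close> on the tree with vertices \<open>a\<close>, \<open>b\<close> and the root;
  the values on the trees not listed are 0.
  The table was found by computer linear algebra, as a solution with small support of the 105 equations
  (one for each binary tree \<open>T\<close>) saying that the signed sum of the values on the
  three contractions of \<open>T\<close> is 0.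
\<close>

definition cocycle_table :: "(nat list \<times> nat list \<times> int) list" where
  "cocycle_table =
  [([1, 2], [1, 2, 3], 1),
   ([1, 2], [1, 2, 4], -1),
   ([1, 2], [1, 2, 3, 4], 1),
   ([1, 2], [1, 2, 5], 1),
   ([1, 2], [1, 2, 3, 5], -1),
   ([1, 2], [1, 2, 4, 5], 1),
   ([1, 3], [4, 5], -1),
   ([1, 3], [1, 3, 4, 5], -1),
   ([2, 3], [4, 5], -1),
   ([2, 3], [2, 3, 4, 5], -1),
   ([1, 2, 3], [4, 5], 1),
   ([1, 4], [3, 5], 1),
   ([1, 4], [1, 3, 4, 5], 1),
   ([2, 4], [3, 5], 1),
   ([2, 4], [2, 3, 4, 5], 1),
   ([1, 2, 4], [3, 5], -1),
   ([3, 4], [1, 3, 4], 1),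
   ([3, 4], [2, 3, 4], 1),
   ([3, 4], [1, 2, 3, 4], -1),
   ([3, 4], [1, 5], 1),
   ([3, 4], [2, 5], 1),
   ([3, 4], [1, 2, 5], -1),
   ([1, 3, 4], [1, 3, 4, 5], -1),
   ([2, 3, 4], [2, 3, 4, 5], -1),
   ([1, 5], [1, 3, 4, 5], -1),
   ([2, 5], [2, 3, 4, 5], -1),
   ([3, 5], [1, 3, 5], -1),
   ([3, 5], [2, 3, 5], -1),
   ([3, 5], [1, 2, 3, 5], 1),
   ([1, 3, 5], [1, 3, 4, 5], 1),
   ([2, 3, 5], [2, 3, 4, 5], 1),
   ([4, 5], [1, 4, 5], 1),
   ([4, 5], [2, 4, 5], 1),
   ([4, 5], [1, 2, 4, 5], -1),
   ([1, 4, 5], [1, 3, 4, 5], -1),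
   ([2, 4, 5], [2, 3, 4, 5], -1)]"

definition table_coeff :: "nat list \<Rightarrow> nat list \<Rightarrow> int" where
  "table_coeff a b = (\<Sum>(a', b', s)\<leftarrow>cocycle_table. if a = a' \<and> b = b' then s else 0)"

definition compatible :: "nat list \<Rightarrow> nat list \<Rightarrow> bool" where
  "compatible a b \<longleftrightarrow> set a \<subseteq> set b \<or> set b \<subseteq> set a \<or> set a \<inter> set b = {}"

text \<open>A loop over tails meets each increasing triple once and lets incompatible vertices be
  filtered out before the inner loops run.\<close>

primrec all_tails :: "('a \<Rightarrow> 'a list \<Rightarrow> bool) \<Rightarrow> 'a list \<Rightarrow> bool" where
  "all_tails P [] = True"
| "all_tails P (a # as) = (P a as \<and> all_tails P as)"

text \<open>
  The definition of \<^const>\<open>children\<close> quantifies over all labels and cannot be executed;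
  \<open>inputs_exec\<close> considers only the labels in \<open>v\<close>.
\<close>

definition inputs_exec :: "nat set set \<Rightarrow> nat set \<Rightarrow> nat set" where
  "inputs_exec T v = Min ` Set.filter (\<lambda>c. c \<subset> v \<and> \<not> (\<exists>d\<in>T. c \<subset> d \<and> d \<subset> v)) (T \<union> (\<lambda>i. {i}) ` v)"

definition parent_exec :: "nat set set \<Rightarrow> nat set \<Rightarrow> nat set" where
  "parent_exec T e = \<Inter> (Set.filter (\<lambda>p. e \<subset> p) T)"

lemma inputs_exec: "inputs_exec = inputs"
proof (intro ext)
  fix T v
  have "Set.filter (\<lambda>c. c \<subset> v \<and> \<not> (\<exists>d\<in>T. c \<subset> d \<and> d \<subset> v)) (T \<union> (\<lambda>i. {i}) ` v) = children T v"
    by (auto simp: children_def)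
  then show "inputs_exec T v = inputs T v" by (simp add: inputs_exec_def inputs_def)
qed

lemma parent_exec: "parent_exec = parent"
  by (simp add: fun_eq_iff parent_exec_def parent_def)

section \<open>Computational check of the cocycle equations\<close>

definition edge_sign :: "nat set set \<Rightarrow> nat set \<Rightarrow> int" where
  "edge_sign T e = glue_sign (inputs T (parent T e)) (Min e) (inputs T e)"

definition edge_sign_exec :: "nat set set \<Rightarrow> nat set \<Rightarrow> int" where
  "edge_sign_exec T e = glue_sign (inputs_exec T (parent_exec T e)) (Min e) (inputs_exec T e)"

text \<open>The signs +, -, + count the edges preceding the contracted one in \<open>Det(T)\<close>.
  If no contraction is in the table, no inputs are computed; otherwise binarity of all vertices is
  computed along with the equation.\<close>

definition tree_ok :: "nat list \<Rightarrow> nat list \<Rightarrow> nat list \<Rightarrow> bool" where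
  "tree_ok a b c =
    (let T = {set a, set b, set c, {1, 2, 3, 4, 5}};
         p = table_coeff b c; q = table_coeff a c; r = table_coeff a b
     in if p = 0 \<and> q = 0 \<and> r = 0 then True
        else (\<forall>v\<in>T. card (inputs_exec T v) = 2) \<and>
          p * edge_sign_exec T (set a) - q * edge_sign_exec T (set b) + r * edge_sign_exec T (set c) = 0)"

text \<open>The triples surviving the filters are, with the root added, the 105 binary trees on five
  leaves.\<close>

lemma all_trees_ok:
  "all_tails (\<lambda>a as. all_tails (\<lambda>b bs. list_all (tree_ok a b) (filter (compatible a) (filter (compatible b) bs))) (filter (compatible a) as)) vertex_sets"
  by code_simp

lemma sorted_vertex_sets: "sorted_wrt (\<lambda>a b. set_encode (set a) < set_encode (set b)) vertex_sets"
  by (simp add: vertex_sets_def set_encode_def)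

text \<open>62 = 2 + 4 + 8 + 16 + 32 is the code of the root \<open>{1..5}\<close>, which therefore
  comes after all other vertices.\<close>

lemma vertex_sets_props: "list_all (\<lambda>a. sorted a \<and> distinct a \<and> set_encode (set a) < 62) vertex_sets"
  by (simp add: vertex_sets_def set_encode_def)

lemma vertex_sets_complete:
  assumes "v \<subseteq> {1..5}" "2 \<le> card v" "v \<noteq> {1..5}"
  shows "v \<in> set ` set vertex_sets"
proof -
  have "\<forall>v\<in>Pow {1, 2, 3, 4, 5}. v \<noteq> {1, 2, 3, 4, 5} \<longrightarrow> 2 \<le> card v \<longrightarrow> v \<in> set ` set vertex_sets"
    by code_simp
  moreover have "{1..5} = {1, 2, 3, 4, 5 :: nat}" by auto
  ultimately show ?thesis using assms by simp
qed

lemma cocycle_table_props: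
  "list_all (\<lambda>(a, b, s). a \<in> set vertex_sets \<and> b \<in> set vertex_sets \<and> set_encode (set a) < set_encode (set b)) cocycle_table"
  by (simp add: cocycle_table_def vertex_sets_def set_encode_def)

section \<open>From the table to a cochain\<close>

definition cocycle_coeff :: "nat set set \<Rightarrow> int" where
  "cocycle_coeff T = (\<Sum>(a, b, s)\<leftarrow>cocycle_table. if T = {set a, set b, {1..5}} then s else 0)"

text \<open>Five leaves and three vertices force the arities 2, 2, 3, where each Q(I) is
  one-dimensional. The product of the sign functionals spans the dual space of the tree, so a
  cochain is one coefficient per tree.\<close>

definition cocycle :: "(unit, 'k::field) cochain" where
  "cocycle T x = (if T \<in> trees 5 \<and> card T = 3 \<and> x \<in> decs T
     then of_int (cocycle_coeff T) * (\<Prod>v\<in>T. vertex_fun (inputs T v) (x v)) else 0)"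

lemma root_5: "{1..5} = {1, 2, 3, 4, 5 :: nat}"
  by auto

lemma vertex_sets_less_root: "a \<in> set vertex_sets \<Longrightarrow> set_encode (set a) < set_encode {1..5}"
  using vertex_sets_props unfolding root_5 by (auto simp: list_all_iff set_encode_def)

lemma set_inj_vertex_sets: "inj_on set (set vertex_sets)"
  using vertex_sets_props by (auto simp: inj_on_def list_all_iff intro: sorted_distinct_set_unique)

lemma encode_pair_unique:
  assumes "set_encode A < set_encode B" "set_encode B < set_encode R"
    and "set_encode A' < set_encode B'" "set_encode B' < set_encode R" and "{A, B, R} = {A', B', R}"
  shows "A = A' \<and> B = B'"
proof -
  have "A \<noteq> R" "B \<noteq> R" "A' \<noteq> R" "B' \<noteq> R" using assms(1-4) by auto
  then have "{A, B} = {A, B, R} - {R}" "{A', B'} = {A', B', R} - {R}"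
    by (simp_all add: insert_Diff_if)
  then have "{A, B} = {A', B'}" using assms(5) by simp
  then show ?thesis using assms(1,3) by (auto simp: doubleton_eq_iff)
qed

text \<open>Both pairs increase in \<open>set_encode\<close> and stay below the root, so the
  unordered family determines the ordered pair of lists.\<close>

lemma cocycle_coeff_eq:
  assumes ab: "a \<in> set vertex_sets" "b \<in> set vertex_sets" "set_encode (set a) < set_encode (set b)"
  shows "cocycle_coeff {set a, set b, {1..5}} = table_coeff a b"
proof -
  have "({set a, set b, {1..5}} = {set a', set b', {1..5}}) \<longleftrightarrow> a = a' \<and> b = b'"
    if t: "(a', b', s) \<in> set cocycle_table" for a' b' s
  proof
    have t': "a' \<in> set vertex_sets" "b' \<in> set vertex_sets" "set_encode (set a') < set_encode (set b')"
      using cocycle_table_props t by (auto simp: list_all_iff)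
    assume "{set a, set b, {1..5}} = {set a', set b', {1..5}}"
    then have "set a = set a' \<and> set b = set b'"
      using ab t' by (intro encode_pair_unique[of _ _ "{1..5}"] vertex_sets_less_root)
    then show "a = a' \<and> b = b'" using set_inj_vertex_sets ab t' by (auto simp: inj_on_def)
  qed simp
  then show ?thesis
    unfolding cocycle_coeff_def table_coeff_def by (intro arg_cong[of _ _ sum_list] map_cong) auto
qed

text \<open>Sortedness makes the tail after \<open>a\<close> contain every element with a larger
  key, so a check over tails covers all increasing pairs.\<close>

lemma all_tails_D:
  assumes "all_tails P xs" "sorted_wrt (\<lambda>a b. f a < (f b :: nat)) xs" "a \<in> set xs"
  obtains ys where "P a ys" "sorted_wrt (\<lambda>a b. f a < f b) ys" "\<And>b. b \<in> set xs \<Longrightarrow> f a < f b \<Longrightarrow> b \<in> set ys"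
  using assms
proof (induction xs arbitrary: thesis)
  case (Cons x xs)
  show ?case
  proof (cases "a = x")
    case True
    then show ?thesis using Cons.prems by (intro Cons.prems(1)[of xs]) auto
  next
    case False
    then have a: "a \<in> set xs" using Cons.prems by simp
    then have "f x < f a" using Cons.prems by simp
    obtain ys where ys: "P a ys" "sorted_wrt (\<lambda>a b. f a < f b) ys" "\<And>b. b \<in> set xs \<Longrightarrow> f a < f b \<Longrightarrow> b \<in> set ys"
      using Cons.IH[OF _ _ _ a] Cons.prems by auto
    show ?thesis
      using ys \<open>f x < f a\<close> by (intro Cons.prems(1)[of ys]) auto
  qed
qed simp

lemma tree_ok_of_compatible:
  assumes abc: "a \<in> set vertex_sets" "b \<in> set vertex_sets" "c \<in> set vertex_sets"
    and less: "set_encode (set a) < set_encode (set b)" "set_encode (set b) < set_encode (set c)"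
    and comp: "compatible a b" "compatible a c" "compatible b c"
  shows "tree_ok a b c"
proof -
  let ?f = "\<lambda>a. set_encode (set a)"
  obtain as where as: "all_tails (\<lambda>b bs. list_all (tree_ok a b) (filter (compatible a) (filter (compatible b) bs))) (filter (compatible a) as)"
    "sorted_wrt (\<lambda>a b. ?f a < ?f b) as" "\<And>b. b \<in> set vertex_sets \<Longrightarrow> ?f a < ?f b \<Longrightarrow> b \<in> set as"
    using all_tails_D[OF all_trees_ok sorted_vertex_sets abc(1)] by blast
  have sorted: "sorted_wrt (\<lambda>a b. ?f a < ?f b) (filter (compatible a) as)"
    using as(2) by (rule sorted_wrt_filter)
  have mem: "b \<in> set (filter (compatible a) as)" using as(3) abc less comp by simp
  obtain bs where bs: "list_all (tree_ok a b) (filter (compatible a) (filter (compatible b) bs))"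
    "\<And>c. c \<in> set (filter (compatible a) as) \<Longrightarrow> ?f b < ?f c \<Longrightarrow> c \<in> set bs"
    using all_tails_D[where f = ?f, OF as(1) sorted mem] by blast
  have "c \<in> set bs" using bs(2) as(3) abc less comp by simp
  then show ?thesis using bs(1) comp by (simp add: list_all_iff)
qed

lemma three_sorted:
  assumes "card S = 3" "inj_on (f :: 'a \<Rightarrow> nat) S"
  obtains a b c where "S = {a, b, c}" "f a < f b" "f b < f c"
proof -
  obtain x y z where S: "S = {x, y, z}" "x \<noteq> y" "y \<noteq> z" "x \<noteq> z" using assms(1) by (auto simp: card_3_iff)
  then have "f x \<noteq> f y" "f y \<noteq> f z" "f x \<noteq> f z" using assms(2) by (auto simp: inj_on_def)
  then consider "f x < f y" "f y < f z" | "f x < f z" "f z < f y" | "f y < f x" "f x < f z"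
    | "f y < f z" "f z < f x" | "f z < f x" "f x < f y" | "f z < f y" "f y < f x"
    by linarith
  then show ?thesis
    using that[of x y z] that[of x z y] that[of y x z] that[of y z x] that[of z x y] that[of z y x] S(1)
    by cases (simp_all add: insert_commute)
qed

lemma binary_tree_cases:
  assumes T: "T \<in> trees 5" "card T = 4"
  obtains a b c where "a \<in> set vertex_sets" "b \<in> set vertex_sets" "c \<in> set vertex_sets"
    "set_encode (set a) < set_encode (set b)" "set_encode (set b) < set_encode (set c)"
    "T = {set a, set b, set c, {1..5}}" "tree_ok a b c"
proof -
  have root: "{1..5} \<in> T" using T by (simp add: trees_def)
  then have "card (T - {{1..5}}) = 3" using T finite_tree[OF T(1)] by simp
  moreover have "inj_on set_encode (T - {{1..5}})"
    using finite_vertex[OF T(1)] by (auto simp: inj_on_def set_encode_eq)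
  ultimately obtain A B C where ABC: "T - {{1..5}} = {A, B, C}" "set_encode A < set_encode B" "set_encode B < set_encode C"
    by (rule three_sorted)
  have "v \<in> set ` set vertex_sets" if "v \<in> T - {{1..5}}" for v
    using T that by (intro vertex_sets_complete) (auto simp: trees_def)
  then have "A \<in> set ` set vertex_sets" "B \<in> set ` set vertex_sets" "C \<in> set ` set vertex_sets"
    unfolding ABC(1) by auto
  then obtain a b c where abc: "a \<in> set vertex_sets" "b \<in> set vertex_sets" "c \<in> set vertex_sets"
    "A = set a" "B = set b" "C = set c" by auto
  have "A \<in> T" "B \<in> T" "C \<in> T" using ABC(1) by auto
  then have "compatible a b" "compatible a c" "compatible b c"
    using tree_laminar[OF T(1)] by (simp_all add: compatible_def abc)
  then have "tree_ok a b c" using abc ABC by (intro tree_ok_of_compatible) auto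
  moreover have "T = {set a, set b, set c, {1..5}}"
    using insert_Diff[OF root] unfolding ABC(1) abc(4-6) by (simp only: insert_commute)
  ultimately show ?thesis using that abc ABC by simp
qed

text \<open>The hypothesis on \<open>e0\<close> singles out the trees on which
  \<open>tree_ok\<close> tests something; on the others every contraction has coefficient zero and
  the terms of the differential vanish one by one.\<close>

lemma cocycle_coeff_equation:
  assumes T: "T \<in> trees 5" "card T = 4" and e: "e0 \<in> T - {{1..5}}" "cocycle_coeff (T - {e0}) \<noteq> 0"
  shows "\<forall>v\<in>T. card (inputs T v) = 2"
    and "(\<Sum>e\<in>T - {{1..5}}. (- 1) ^ card {f \<in> T. set_encode f < set_encode e} * (cocycle_coeff (T - {e}) * edge_sign T e)) = 0"
proof -
  obtain a b c where abc: "a \<in> set vertex_sets" "b \<in> set vertex_sets" "c \<in> set vertex_sets"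
    and less: "set_encode (set a) < set_encode (set b)" "set_encode (set b) < set_encode (set c)"
    and Teq: "T = {set a, set b, set c, {1..5}}" and ok: "tree_ok a b c"
    using binary_tree_cases[OF T] .
  let ?A = "set a" and ?B = "set b" and ?C = "set c" and ?R = "{1..5} :: nat set"
  note lessR = vertex_sets_less_root[OF abc(1)] vertex_sets_less_root[OF abc(2)] vertex_sets_less_root[OF abc(3)]
  have ne: "?A \<noteq> ?B" "?B \<noteq> ?C" "?A \<noteq> ?C" "?A \<noteq> ?R" "?B \<noteq> ?R" "?C \<noteq> ?R"
    using less lessR by auto
  have edges: "T - {?R} = {?A, ?B, ?C}" using ne by (simp add: Teq insert_Diff_if)
  have "T - {?A} = {?B, ?C, ?R}" "T - {?B} = {?A, ?C, ?R}" "T - {?C} = {?A, ?B, ?R}"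
    using ne ne[symmetric] by (simp_all add: Teq insert_Diff_if)
  then have coeffs: "cocycle_coeff (T - {?A}) = table_coeff b c" "cocycle_coeff (T - {?B}) = table_coeff a c"
    "cocycle_coeff (T - {?C}) = table_coeff a b"
    using abc less by (simp_all only: cocycle_coeff_eq less_trans[OF less])
  have filter: "{x \<in> insert v S. P x} = (if P v then insert v {x \<in> S. P x} else {x \<in> S. P x})"
    for v S and P :: "nat set \<Rightarrow> bool" by auto
  \<comment> \<open>The root has the largest code and is never counted, so the exponents of -1 are
    0, 1, 2.\<close>
  have below: "{f \<in> T. set_encode f < set_encode ?A} = {}" "{f \<in> T. set_encode f < set_encode ?B} = {?A}"
    "{f \<in> T. set_encode f < set_encode ?C} = {?A, ?B}"
    unfolding Teq filter using less lessR by simp_all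
  have cards: "card {f \<in> T. set_encode f < set_encode ?A} = 0" "card {f \<in> T. set_encode f < set_encode ?B} = 1"
    "card {f \<in> T. set_encode f < set_encode ?C} = 2"
    unfolding below using ne by simp_all
  have "table_coeff b c \<noteq> 0 \<or> table_coeff a c \<noteq> 0 \<or> table_coeff a b \<noteq> 0"
    using e coeffs unfolding edges by auto
  then have *: "\<forall>v\<in>T. card (inputs T v) = 2"
    "table_coeff b c * edge_sign T ?A - table_coeff a c * edge_sign T ?B + table_coeff a b * edge_sign T ?C = 0"
    using ok unfolding tree_ok_def Let_def edge_sign_exec_def inputs_exec parent_exec edge_sign_def
    unfolding Teq root_5 by presburger+
  show "\<forall>v\<in>T. card (inputs T v) = 2" by (rule *)
  show "(\<Sum>e\<in>T - {{1..5}}. (- 1) ^ card {f \<in> T. set_encode f < set_encode e} * (cocycle_coeff (T - {e}) * edge_sign T e)) = 0"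
    unfolding edges using ne *(2) by (simp add: coeffs cards)
qed

section \<open>The cocycle property\<close>

lemma cocycle_in_cobar: "cocycle \<in> cobar (quad_dual JaJo :: (unit, 'k::field) quadratic) 5 3"
proof -
  have "(cocycle T :: (nat set \<Rightarrow> (unit, 'k) vec) \<Rightarrow> 'k) \<in> dual_space (quad_dual JaJo) T"
    if T: "T \<in> trees 5" "card T = 3" for T
  proof -
    have fin: "finite T" using finite_tree[OF T(1)] .
    let ?F = "\<lambda>x v. vertex_fun (inputs T v) (x v) :: 'k"
    have eq: "cocycle T x = of_int (cocycle_coeff T) * (\<Prod>v\<in>T. ?F x v)" if "x \<in> decs T" for x
      using T that by (simp add: cocycle_def)
    have upd: "cocycle T (x(v := y)) = of_int (cocycle_coeff T) * (\<Prod>w\<in>T - {v}. ?F x w) * vertex_fun (inputs T v) y"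
      if x: "x \<in> decs T" and v: "v \<in> T" and y: "y \<in> vecs (inputs T v)" for x v y
    proof -
      have "x(v := y) \<in> decs T" using fun_upd_in_PiE[of x] x v y unfolding decs_def
        by (auto simp: PiE_iff extensional_def)
      moreover have "(\<Prod>w\<in>T. ?F (x(v := y)) w) = vertex_fun (inputs T v) y * (\<Prod>w\<in>T - {v}. ?F x w)"
        by (simp add: prod.remove[OF fin v])
      ultimately show ?thesis by (simp add: eq)
    qed
    have "cocycle T x = (0 :: 'k)" if "x \<notin> decs T" for x using that by (simp add: cocycle_def)
    moreover have "cocycle T (x(v := (\<lambda>t. c * y t + z t))) = c * cocycle T (x(v := y)) + (cocycle T (x(v := z)) :: 'k)"
      if "x \<in> decs T" "v \<in> T" "y \<in> vecs (inputs T v)" "z \<in> vecs (inputs T v)" for x v y z c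
      using that by (simp add: upd vecs_lin vertex_fun_lin[of y "inputs T v" z]) (simp add: algebra_simps)
    moreover have "cocycle T x = 0"
      if "x \<in> decs T" "v \<in> T" "ideal (quad_dual JaJo :: (unit, 'k) quadratic) (inputs T v) (x v)" for x v
      using that vertex_fun_ideal[OF that(3)] fin by (auto simp: eq intro!: prod_zero)
    ultimately show ?thesis unfolding dual_space_def by blast
  qed
  moreover have "cocycle T = (\<lambda>_. 0 :: 'k)" if "\<not> (T \<in> trees 5 \<and> card T = 3)" for T
    using that by (auto simp: cocycle_def fun_eq_iff)
  ultimately show ?thesis by (simp add: cobar_def)
qed

text \<open>Only the factor at the parent changes, and \<open>vertex_fun_pcomp\<close> splits it
  into the factors of the two merged vertices up to sign. Every contraction of \<open>T\<close> is
  thus an integer multiple of one product over \<open>T\<close>, which can be pulled out of the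
  differential.\<close>

lemma cocycle_contract:
  assumes T: "T \<in> trees 5" "card T = 4" and binary: "\<forall>v\<in>T. card (inputs T v) = 2"
    and e: "e \<in> T" "e \<noteq> {1..5}" and x: "x \<in> decs T"
  shows "cocycle (T - {e}) (contract T e x) =
    of_int (cocycle_coeff (T - {e}) * edge_sign T e) * (\<Prod>v\<in>T. vertex_fun (inputs T v) (x v))"
proof -
  let ?p = "parent T e" and ?T = "T - {e}"
  let ?F = "\<lambda>v. vertex_fun (inputs T v) (x v)"
  note p = parent_props[OF T(1) e]
  note inp = inputs_contract_parent[OF T(1) e]
  have fin: "finite T" using finite_tree[OF T(1)] .
  have p': "?p \<in> ?T" using p(1,2) by auto
  have vecs: "x v \<in> vecs (inputs T v)" if "v \<in> T" for v using x that by (auto simp: decs_def)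
  have "card ?T = 3" using T(2) e(1) fin by simp
  then have "cocycle ?T (contract T e x) =
      of_int (cocycle_coeff ?T) * (\<Prod>v\<in>?T. vertex_fun (inputs ?T v) (contract T e x v))"
    using contract_in_decs[OF T(1) e x] tree_remove[OF T(1) e(2)] by (simp add: cocycle_def)
  also have "(\<Prod>v\<in>?T. vertex_fun (inputs ?T v) (contract T e x v)) =
      vertex_fun (inputs ?T ?p) (contract T e x ?p) * (\<Prod>v\<in>?T - {?p}. vertex_fun (inputs ?T v) (contract T e x v))"
    using fin p' by (intro prod.remove) simp_all
  also have "(\<Prod>v\<in>?T - {?p}. vertex_fun (inputs ?T v) (contract T e x v)) = (\<Prod>v\<in>?T - {?p}. ?F v)"
    by (intro prod.cong refl) (simp add: contract_def inputs_contract_other[OF T(1) e])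
  also have "vertex_fun (inputs ?T ?p) (contract T e x ?p) = of_int (edge_sign T e) * ?F ?p * ?F e"
    using p' p(1) e(1) binary vecs
    by (simp add: contract_def inp(1) edge_sign_def vertex_fun_pcomp[OF _ inp(3) _ inp(2)])
  also have "(\<Prod>v\<in>T. ?F v) = ?F e * (?F ?p * (\<Prod>v\<in>?T - {?p}. ?F v))"
    using fin p' e(1) by (simp add: prod.remove[of T e] prod.remove[of ?T ?p])
  ultimately show ?thesis by (simp add: mult_ac)
qed

lemma cobar_d_cocycle: "cobar_d 5 cocycle = (\<lambda>_ _. 0 :: 'k::field)"
proof (intro ext)
  fix T and x :: "nat set \<Rightarrow> (unit, 'k) vec"
  show "cobar_d 5 cocycle T x = 0"
  proof (cases "T \<in> trees 5 \<and> x \<in> decs T")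
    case True
    then have T: "T \<in> trees 5" and x: "x \<in> decs T" by auto
    let ?s = "\<lambda>e. (- 1) ^ card {f \<in> T. set_encode f < set_encode e}"
    have d: "cobar_d 5 cocycle T x = (\<Sum>e\<in>T - {{1..5}}. ?s e * cocycle (T - {e}) (contract T e x))"
      using T x by (simp add: cobar_d_def)
    show ?thesis
    proof (cases "card T = 4 \<and> (\<exists>e\<in>T - {{1..5}}. cocycle_coeff (T - {e}) \<noteq> 0)")
      case True
      then obtain e0 where e0: "e0 \<in> T - {{1..5}}" "cocycle_coeff (T - {e0}) \<noteq> 0" and c: "card T = 4" by blast
      let ?X = "\<Prod>v\<in>T. vertex_fun (inputs T v) (x v)"
      have "(\<Sum>e\<in>T - {{1..5}}. ?s e * cocycle (T - {e}) (contract T e x)) =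
          (\<Sum>e\<in>T - {{1..5}}. of_int (?s e * (cocycle_coeff (T - {e}) * edge_sign T e)) * ?X)"
        using cocycle_contract[OF T c cocycle_coeff_equation(1)[OF T c e0] _ _ x]
        by (intro sum.cong refl) (simp add: mult.assoc)
      also have "\<dots> = of_int (\<Sum>e\<in>T - {{1..5}}. ?s e * (cocycle_coeff (T - {e}) * edge_sign T e)) * ?X"
        by (simp only: of_int_sum sum_distrib_right)
      also have "\<dots> = 0" by (simp only: cocycle_coeff_equation(2)[OF T c e0] of_int_0 mult_zero_left)
      finally show ?thesis by (simp add: d)
    next
      case False
      have "cocycle (T - {e}) (contract T e x) = 0" if e: "e \<in> T - {{1..5}}" for e
      proof (cases "card T = 4")
        case True
        then show ?thesis using False e by (simp add: cocycle_def)
      next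
        case False
        then have "card (T - {e}) \<noteq> 3" using e finite_tree[OF T] by (simp add: card_Diff_singleton_if)
        then show ?thesis by (simp add: cocycle_def)
      qed
      then show ?thesis unfolding d by (intro sum.neutral) simp
    qed
  qed (auto simp: cobar_d_def)
qed

section \<open>A decorated tree on which coboundaries vanish\<close>

definition witness_tree :: "nat set set" where
  "witness_tree = {{1, 2}, {1, 2, 3, 4}, {1..5}}"

text \<open>The arities along the chain are 2, 3, 2, so both edges join the ternary vertex to a
  binary one. With these monomials either contraction creates a single left-normed monomial,
  \<open>((1 2) 3) 4\<close> or \<open>((1 3) 4) 5\<close>.\<close>

definition witness_dec :: "nat set \<Rightarrow> (unit, 'k::field) vec" where
  "witness_dec = (\<lambda>v\<in>witness_tree. if v = {1, 2} then single (Lf 1 \<odot> Lf 2)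
     else if v = {1, 2, 3, 4} then single ((Lf 1 \<odot> Lf 3) \<odot> Lf 4) else single (Lf 1 \<odot> Lf 5))"

lemma witness_tree_facts:
  "inputs witness_tree {1, 2} = {1, 2}" "inputs witness_tree {1, 2, 3, 4} = {1, 3, 4}" "inputs witness_tree {1, 2, 3, 4, 5} = {1, 5}"
  "parent witness_tree {1, 2} = {1, 2, 3, 4}" "parent witness_tree {1, 2, 3, 4} = {1, 2, 3, 4, 5}"
proof -
  have "inputs_exec {{1, 2}, {1, 2, 3, 4}, {1, 2, 3, 4, 5}} {1, 2} = {1, 2}"
    "inputs_exec {{1, 2}, {1, 2, 3, 4}, {1, 2, 3, 4, 5}} {1, 2, 3, 4} = {1, 3, 4}"
    "inputs_exec {{1, 2}, {1, 2, 3, 4}, {1, 2, 3, 4, 5}} {1, 2, 3, 4, 5} = {1, 5}"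
    by code_simp+
  then show "inputs witness_tree {1, 2} = {1, 2}" "inputs witness_tree {1, 2, 3, 4} = {1, 3, 4}" "inputs witness_tree {1, 2, 3, 4, 5} = {1, 5}"
    by (simp_all only: witness_tree_def root_5 inputs_exec)
  have "parent_exec {{1, 2}, {1, 2, 3, 4}, {1, 2, 3, 4, 5}} {1, 2} = {1, 2, 3, 4}"
    "parent_exec {{1, 2}, {1, 2, 3, 4}, {1, 2, 3, 4, 5}} {1, 2, 3, 4} = {1, 2, 3, 4, 5}"
    by code_simp+
  then show "parent witness_tree {1, 2} = {1, 2, 3, 4}" "parent witness_tree {1, 2, 3, 4} = {1, 2, 3, 4, 5}"
    by (simp_all only: witness_tree_def root_5 parent_exec)
qed

lemma witness_tree_in_trees: "witness_tree \<in> trees 5"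
  by (auto simp: witness_tree_def trees_def)

lemma ball_witness_tree: "(\<forall>v\<in>witness_tree. P v) \<longleftrightarrow> P {1, 2} \<and> P {1, 2, 3, 4} \<and> P {1, 2, 3, 4, 5}"
  unfolding witness_tree_def root_5 by simp

lemma witness_dec_simps:
  "witness_dec {1, 2} = (single (Lf 1 \<odot> Lf 2) :: (unit, 'k::field) vec)"
  "witness_dec {1, 2, 3, 4} = (single ((Lf 1 \<odot> Lf 3) \<odot> Lf 4) :: (unit, 'k) vec)"
  "witness_dec {1, 2, 3, 4, 5} = (single (Lf 1 \<odot> Lf 5) :: (unit, 'k) vec)"
proof -
  have "{1, 2, 3, 4} \<noteq> {1, 2 :: nat}" "{1, 2, 3, 4, 5} \<noteq> {1, 2 :: nat}" "{1, 2, 3, 4, 5} \<noteq> {1, 2, 3, 4 :: nat}"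
    by code_simp+
  then show "witness_dec {1, 2} = (single (Lf 1 \<odot> Lf 2) :: (unit, 'k) vec)"
    "witness_dec {1, 2, 3, 4} = (single ((Lf 1 \<odot> Lf 3) \<odot> Lf 4) :: (unit, 'k) vec)"
    "witness_dec {1, 2, 3, 4, 5} = (single (Lf 1 \<odot> Lf 5) :: (unit, 'k) vec)"
    unfolding witness_dec_def witness_tree_def root_5 by (simp_all only: restrict_apply insert_iff simp_thms if_True if_False)
qed

lemma witness_dec_in_decs: "(witness_dec :: nat set \<Rightarrow> (unit, 'k::field) vec) \<in> decs witness_tree"
proof -
  have "Lf 1 \<odot> Lf 2 \<in> mons {1, 2}" "(Lf 1 \<odot> Lf 3) \<odot> Lf 4 \<in> mons {1, 3, 4}" "Lf 1 \<odot> Lf 5 \<in> mons {1, 5}"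
    by (auto simp: mons_def)
  then have "\<forall>v\<in>witness_tree. witness_dec v \<in> (vecs (inputs witness_tree v) :: (unit, 'k) vec set)"
    unfolding ball_witness_tree witness_tree_facts witness_dec_simps by (intro conjI single_in_vecs)
  moreover have "witness_dec \<in> extensional witness_tree" by (simp add: witness_dec_def)
  ultimately show ?thesis by (simp add: decs_def PiE_iff)
qed

lemma vertex_fun_nonzero:
  "i \<noteq> j \<Longrightarrow> vertex_fun {i, j} (single (Lf i \<odot> Lf j)) \<noteq> (0 :: 'k::field)"
  "distinct [i, j, k] \<Longrightarrow> vertex_fun {i, j, k} (single ((Lf i \<odot> Lf j) \<odot> Lf k)) \<noteq> (0 :: 'k::field)"
proof -
  show "vertex_fun {i, j} (single (Lf i \<odot> Lf j)) \<noteq> (0 :: 'k)" if "i \<noteq> j"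
  proof -
    have "single (Lf i \<odot> Lf j) \<in> (vecs {i, j} :: (unit, 'k) vec set)"
      using that by (intro single_in_vecs) (auto simp: mons_def)
    then show ?thesis using that by (auto simp: vertex_fun_pair single_def order_sign_def)
  qed
  show "vertex_fun {i, j, k} (single ((Lf i \<odot> Lf j) \<odot> Lf k)) \<noteq> (0 :: 'k)" if "distinct [i, j, k]"
  proof -
    have "card {i, j, k} = 3" using that by simp
    then have "vertex_fun {i, j, k} (single ((Lf i \<odot> Lf j) \<odot> Lf k)) =
        (of_int (order_sign i j * order_sign i k * order_sign j k) :: 'k)"
      using det_rank_basis[of k i j "{i, j, k}"] that by (auto simp: vertex_fun_def pairing_single insert_commute)
    then show ?thesis using that by (auto simp: order_sign_def)
  qed
qed

text \<open>The table entry is 1 and the functionals take values 1 or -1, so the product is nonzero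
  in every field.\<close>

lemma cocycle_witness_dec: "cocycle witness_tree (witness_dec :: nat set \<Rightarrow> (unit, 'k::field) vec) \<noteq> 0"
proof -
  have "cocycle_coeff witness_tree = table_coeff [1, 2] [1, 2, 3, 4]"
    using cocycle_coeff_eq[of "[1, 2]" "[1, 2, 3, 4]"]
    by (simp add: witness_tree_def vertex_sets_def set_encode_def)
  also have "\<dots> = 1" by code_simp
  finally have "cocycle_coeff witness_tree = 1" .
  moreover have "\<forall>v\<in>witness_tree. vertex_fun (inputs witness_tree v) (witness_dec v) \<noteq> (0 :: 'k)"
    unfolding ball_witness_tree witness_tree_facts witness_dec_simps by (intro conjI vertex_fun_nonzero) simp_all
  moreover have "card witness_tree = 3" unfolding witness_tree_def root_5 by code_simp
  ultimately show ?thesis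
    using witness_tree_in_trees witness_dec_in_decs finite_tree[OF witness_tree_in_trees] by (simp add: cocycle_def)
qed

lemma ideal_dual_left_normed:
  assumes "distinct [i, j, k, l]"
  shows "ideal (quad_dual JaJo :: (unit, 'k::field_char_0) quadratic) {i, j, k, l}
    (single (((Lf i \<odot> Lf j) \<odot> Lf k) \<odot> Lf l))"
proof -
  let ?Q = "quad_dual JaJo :: (unit, 'k) quadratic"
  let ?w = "((Lf 1 \<odot> Lf 2) \<odot> Lf 3) \<odot> Lf 4"
  let ?\<sigma> = "Lf(1 := Lf i, 2 := Lf j, 3 := Lf k, 4 := Lf l)"
  \<comment> \<open>The coefficient 0 presents a single monomial as a two-term vector, so that
    \<open>ideal_subst\<close> can rename its letters.\<close>
  have "ideal ?Q {1, 2, 3, 4} (two_term ?w 0 ?w)"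
    using ideal_dual_arity_four by (simp add: two_term_def)
  then have "ideal ?Q (labels (subst ?\<sigma> ?w)) (two_term (subst ?\<sigma> ?w) 0 (subst ?\<sigma> ?w))"
    by (rule ideal_subst) (use assms in \<open>auto split: if_splits\<close>)
  moreover have "labels (subst ?\<sigma> ?w) = {i, j, k, l}" by auto
  ultimately show ?thesis by (simp add: two_term_def)
qed

lemma dual_space_ideal:
  assumes "\<phi> \<in> dual_space Q T" "x \<in> decs T" "v \<in> T" "ideal Q (inputs T v) (x v)"
  shows "\<phi> x = 0"
  using assms unfolding dual_space_def by blast

text \<open>The values of a cochain are functionals that vanish once some vertex carries an element
  of the ideal; here it is the vertex created by the contraction.\<close>

lemma cobar_contract_zero:
  assumes \<Psi>: "\<Psi> \<in> cobar Q n m" and T: "T \<in> trees n" "card T = Suc m" and e: "e \<in> T" "e \<noteq> {1..n}"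
    and x: "x \<in> decs T"
    and ideal: "ideal Q ((inputs T (parent T e) - {Min e}) \<union> inputs T e) (pcomp (Min e) (x (parent T e)) (x e))"
  shows "\<Psi> (T - {e}) (contract T e x) = 0"
proof -
  have "card (T - {e}) = m" using T(2) e(1) finite_tree[OF T(1)] by simp
  then have "\<Psi> (T - {e}) \<in> dual_space Q (T - {e})"
    using \<Psi> tree_remove[OF T(1) e(2)] unfolding cobar_def by simp
  moreover have p: "parent T e \<in> T - {e}" using parent_props(1,2)[OF T(1) e] by auto
  moreover have "ideal Q (inputs (T - {e}) (parent T e)) (contract T e x (parent T e))"
    using ideal p by (simp add: contract_def inputs_contract_parent(1)[OF T(1) e])
  ultimately show ?thesis
    using contract_in_decs[OF T(1) e x] by (intro dual_space_ideal)
qed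

lemma cobar_d_witness_dec:
  assumes "\<Psi> \<in> cobar (quad_dual JaJo :: (unit, 'k::field_char_0) quadratic) 5 2"
  shows "cobar_d 5 \<Psi> witness_tree witness_dec = 0"
proof -
  have card: "card witness_tree = Suc 2" unfolding witness_tree_def root_5 by code_simp
  have mem: "{1, 2} \<in> witness_tree" "{1, 2, 3, 4} \<in> witness_tree"
    unfolding witness_tree_def root_5 by simp_all
  have ne: "{1, 2} \<noteq> {1..5::nat}" "{1, 2, 3, 4} \<noteq> {1..5::nat}" unfolding root_5 by code_simp+
  have Min: "Min {1, 2} = (1::nat)" "Min {1, 2, 3, 4} = (1::nat)" by simp_all
  have labels: "{1, 3, 4} - {1} \<union> {1, 2} = {1, 2, 3, 4 :: nat}" "{1, 5} - {1} \<union> {1, 3, 4} = {1, 3, 4, 5 :: nat}" by auto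
  have "\<Psi> (witness_tree - {{1, 2}}) (contract witness_tree {1, 2} witness_dec) = 0"
  proof (rule cobar_contract_zero[OF assms witness_tree_in_trees card mem(1) ne(1) witness_dec_in_decs])
    show "ideal (quad_dual JaJo :: (unit, 'k) quadratic)
      (inputs witness_tree (parent witness_tree {1, 2}) - {Min {1, 2}} \<union> inputs witness_tree {1, 2})
      (pcomp (Min {1, 2}) (witness_dec (parent witness_tree {1, 2})) (witness_dec {1, 2}))"
      using ideal_dual_left_normed[of 1 2 3 4] unfolding witness_tree_facts witness_dec_simps Min labels pcomp_single by simp
  qed
  moreover have "\<Psi> (witness_tree - {{1, 2, 3, 4}}) (contract witness_tree {1, 2, 3, 4} witness_dec) = 0"
  proof (rule cobar_contract_zero[OF assms witness_tree_in_trees card mem(2) ne(2) witness_dec_in_decs])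
    show "ideal (quad_dual JaJo :: (unit, 'k) quadratic)
      (inputs witness_tree (parent witness_tree {1, 2, 3, 4}) - {Min {1, 2, 3, 4}} \<union> inputs witness_tree {1, 2, 3, 4})
      (pcomp (Min {1, 2, 3, 4}) (witness_dec (parent witness_tree {1, 2, 3, 4})) (witness_dec {1, 2, 3, 4}))"
      using ideal_dual_left_normed[of 1 3 4 5] unfolding witness_tree_facts witness_dec_simps Min labels pcomp_single by simp
  qed
  moreover have "witness_tree - {{1..5}} = {{1, 2}, {1, 2, 3, 4}}"
    using ne by (simp add: witness_tree_def insert_Diff_if)
  ultimately have "\<forall>e\<in>witness_tree - {{1..5}}. \<Psi> (witness_tree - {e}) (contract witness_tree e witness_dec) = 0" by simp
  then show ?thesis by (simp add: cobar_d_def)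
qed

theorem theorem25:
  shows "\<not> koszul (JaJo :: (unit, 'k::field_char_0) quadratic)"
proof
  let ?Q = "quad_dual JaJo :: (unit, 'k) quadratic"
  assume "koszul (JaJo :: (unit, 'k) quadratic)"
  then have "\<forall>k<5 - 1. cocycles ?Q 5 k = coboundaries ?Q 5 k"
    unfolding koszul_def by (elim allE[of _ 5]) simp
  \<comment> \<open>The violated condition is exactness in arity 5, one degree below the top;
    coboundaries there come from trees with two vertices.\<close>
  then have "cocycles ?Q 5 3 = coboundaries ?Q 5 3" by simp
  moreover have "cocycle \<in> cocycles ?Q 5 3"
    by (simp add: cocycles_def cocycle_in_cobar cobar_d_cocycle)
  ultimately obtain \<Psi> where "\<Psi> \<in> cobar ?Q 5 2" "cocycle = cobar_d 5 \<Psi>"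
    by (auto simp: coboundaries_def)
  then show False using cobar_d_witness_dec[of \<Psi>] cocycle_witness_dec[where 'k = 'k] by simp
qed

end
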